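(* Let $1 \leq k<d$ be integers, and let $X \subseteq \mathbb{R}^k$ and $Y \subseteq \mathbb{R}^{d-k}$ be non-empty compact sets. Then \[ \dim^\theta_{\mathrm{F}} (X \times Y) \geq \min\Big\{ k\theta +\mathrm{E}\!\dim^\theta_{\mathrm{F}} Y , \ \mathrm{E}\!\dim^\theta_{\mathrm{F}} X + (d-k)\theta, \ \mathrm{E}\!\dim^\theta_{\mathrm{F}} X + \mathrm{E}\!\dim^\theta_{\mathrm{F}} Y , \ d\Big\} \] and \[ \dim^\theta_{\mathrm{F}} (X \times Y) \leq \min\Big\{ k\theta +\mathrm{E}\!\dim^\theta_{\mathrm{F}} Y , \ \mathrm{E}\!\dim^\theta_{\mathrm{F}} X + (d-k)\theta, \ d \Big\} \] for all $\theta \in [0,1]$. In particular, $\dim_{\mathrm{F}} (X \times Y) = \min \{ \mathrm{E}\!\dim_{\mathrm{F}} X , \mathrm{E}\!\dim_{\mathrm{F}} Y , d \}$, and if both $X$ and $Y$ have zero Lebesgue measure ($k$-dimensional and $(d-k)$-dimensional, respectively), then $\dim_{\mathrm{F}} (X \times Y) = \min \{ \dim_{\mathrm{F}} X , \dim_{\mathrm{F}} Y \}$.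
   Context: All finite Borel measures are assumed to be non-zero, and $\mathrm{spt}(m)$ denotes the support of $m$. For a finite Borel measure $m$ on $\mathbb{R}^n$, the Fourier transform is $\widehat m(z) = \int e^{-2\pi i z\cdot x}\, dm(x)$. For $s \geq 0$ and $\theta\in(0,1]$ define \[ \mathcal{J}_{s,\theta}(m) = \left( \int_{\mathbb{R}^n} |\widehat m(z)|^{2/\theta} |z|^{s/\theta-n} \, dz \right)^{\theta}, \] and $\mathcal{J}_{s,0}(m) = \sup_{z \in \mathbb{R}^n} |\widehat m(z)|^{2} |z|^{s}$. The Fourier spectrum of $m$ at $\theta\in[0,1]$ is $\dim^\theta_{\mathrm{F}} m = \sup\{s \geq 0 : \mathcal{J}_{s,\theta}(m) < \infty\} \in [0,\infty]$, with $\sup\emptyset=0$. For a set $A\subseteq\mathbb{R}^n$ and $\theta\in[0,1]$, the Fourier spectrum and extended Fourier spectrum of $A$ are \[ \dim^\theta_{\mathrm{F}} A = \sup\{\min\{\dim^\theta_{\mathrm{F}} m, n\} : \mathrm{spt}(m)\subseteq A\}, \qquad \mathrm{E}\!\dim^\theta_{\mathrm{F}} A = \sup\{\dim^\theta_{\mathrm{F}} m : \mathrm{spt}(m)\subseteq A\}, \] where the suprema are over finite Borel measures $m$ on $\mathbb{R}^n$ supported by $A$ (the second may equal $\infty$). The Fourier dimension and extended Fourier dimension of $A$ are $\dim_{\mathrm{F}} A = \dim^0_{\mathrm{F}} A$ and $\mathrm{E}\!\dim_{\mathrm{F}} A = \mathrm{E}\!\dim^0_{\mathrm{F}} A$. Each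 is taken with respect to the ambient space: $\mathbb{R}^k$ for $X$, $\mathbb{R}^{d-k}$ for $Y$, $\mathbb{R}^d$ for $X\times Y$. *)

theory Defs
  imports "HOL-Analysis.Analysis"
begin

definition nonzero_finite_borel_measure :: "'a::euclidean_space measure \<Rightarrow> bool" where
  "nonzero_finite_borel_measure m \<longleftrightarrow>
     finite_measure m \<and> sets m = sets borel \<and> emeasure m (space m) \<noteq> 0"

definition spt :: "'a::euclidean_space measure \<Rightarrow> 'a set" where
  "spt m = {x. \<forall>U. open U \<and> x \<in> U \<longrightarrow> emeasure m U > 0}"

definition fourier_transform :: "'a::euclidean_space measure \<Rightarrow> 'a \<Rightarrow> complex" where
  "fourier_transform m z = (\<integral>x. exp (- 2 * complex_of_real pi * \<i> * complex_of_real (z \<bullet> x)) \<partial>m)"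

definition ennreal_powr :: "ennreal \<Rightarrow> real \<Rightarrow> ennreal" where
  "ennreal_powr t p = (if t = \<infinity> then \<infinity> else ennreal (enn2real t powr p))"

(* Since 0 powr a = 0 for every real a (including a = 0), the value of the integrand or of the
   function under the supremum may differ from the usual convention at z = 0. This is a null set
   for the integral. In the supremum it only concerns s = 0, where it is harmless because the
   Fourier transform is continuous and the dimension is positive.
   The energy is meant for s \<ge> 0 and 0 \<le> \<theta> \<le> 1 only. *)
definition energy :: "real \<Rightarrow> real \<Rightarrow> 'a::euclidean_space measure \<Rightarrow> ennreal" where
  "energy s \<theta> m =
     (if \<theta> = 0
      then (SUP z. ennreal ((cmod (fourier_transform m z))\<^sup>2 * norm z powr s))
      else ennreal_powr
        (\<integral>\<^sup>+z. ennreal (cmod (fourier_transform m z) powr (2 / \<theta>)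
                 * norm z powr (s / \<theta> - real DIM('a))) \<partial>lborel) \<theta>)"

(* Suprema are taken in ennreal, i.e. in [0, \<infinity>], where the supremum of the empty set is 0. *)
definition measure_fourier_spectrum :: "real \<Rightarrow> 'a::euclidean_space measure \<Rightarrow> ennreal" where
  "measure_fourier_spectrum \<theta> m = Sup {ennreal s |s. 0 \<le> s \<and> energy s \<theta> m < \<infinity>}"

definition fourier_spectrum :: "real \<Rightarrow> 'a::euclidean_space set \<Rightarrow> ennreal" where
  "fourier_spectrum \<theta> A =
     Sup {min (measure_fourier_spectrum \<theta> m) (of_nat DIM('a)) |m.
            nonzero_finite_borel_measure m \<and> spt m \<subseteq> A}"

definition ext_fourier_spectrum :: "real \<Rightarrow> 'a::euclidean_space set \<Rightarrow> ennreal" where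
  "ext_fourier_spectrum \<theta> A =
     Sup {measure_fourier_spectrum \<theta> m |m. nonzero_finite_borel_measure m \<and> spt m \<subseteq> A}"

definition fourier_dim :: "'a::euclidean_space set \<Rightarrow> ennreal" where
  "fourier_dim A = fourier_spectrum 0 A"

definition ext_fourier_dim :: "'a::euclidean_space set \<Rightarrow> ennreal" where
  "ext_fourier_dim A = ext_fourier_spectrum 0 A"

end

theory Submission
  imports Defs
begin

text \<open>
  The lower bound uses product measures.  The transform of \<open>\<mu> \<Otimes>\<^sub>M \<nu>\<close> is
  the product of the transforms, so only the weight \<open>norm (x, y) powr (s / \<theta> - DIM('a) - DIM('b))\<close>
  couples the two variables.  Cutting each variable at radius 1 leaves four regions; on each of them
  the weight is dominated by a product of powers of \<open>norm x\<close> and \<open>norm y\<close> which the two factors can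
  afford (\<open>product_energy_finite\<close>).  The three sums in the minimum are exactly what is needed
  where \<open>x\<close> is small and \<open>y\<close> large, the reverse, and where both are large.

  The upper bound projects a measure \<open>m\<close> on \<open>X \<times> Y\<close> to a factor.  The transform of the plain
  projection is the restriction of the transform of \<open>m\<close> to a subspace, about which an integral says
  nothing.  Hence \<open>m\<close> is first multiplied by a positive function of \<open>x\<close> whose spectrum is compact:
  the transform of the projection is then an average of the transform of \<open>m\<close> over the frequencies
  \<open>(\<xi>, y)\<close> with \<open>\<xi>\<close> in a ball, and Jensen's inequality bounds its power by the average
  of the powers (\<open>exists_projection\<close>, \<open>projection_energy_finite\<close>).  The weight cannot be
  compactly supported, but it only has to be positive on the bounded set \<open>X\<close>.

  For null sets, Fourier decay beyond the dimension of the ambient space would make the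
  transform of the measure square integrable.  A square integrable transform bounds the mass of pairs of points at
  distance \<open>r\<close> by a multiple of the volume of an \<open>r\<close>-ball, and by Cauchy--Schwarz the total mass is then controlled by the
  volume of the \<open>r\<close>-neighbourhood of the support, which tends to 0
  (\<open>nn_integral_fourier_transform_null_set\<close>).  So no measure on a null set has Fourier
  dimension above the ambient dimension, and the two Fourier dimensions of a null set agree.

  Both arguments need one positive function with compactly supported spectrum, the squared
  modulus of the transform of the indicator of a ball.  It is the transform of the autocorrelation
  of the ball, and Fubini's theorem replaces Fourier inversion throughout
  (\<open>fourier_multiplication_formula\<close>).
\<close>

section \<open>Characters and Fourier transforms of finite measures\<close>

definition finite_borel_measure :: "'a::euclidean_space measure \<Rightarrow> bool" where
  "finite_borel_measure m \<longleftrightarrow> finite_measure m \<and> sets m = sets borel"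

definition character :: "'a::euclidean_space \<Rightarrow> 'a \<Rightarrow> complex" where
  "character z x = cis (- (2 * pi * (z \<bullet> x)))"

lemma nonzero_finite_borel_measure_iff:
  "nonzero_finite_borel_measure m \<longleftrightarrow> finite_borel_measure m \<and> emeasure m UNIV \<noteq> 0"
proof -
  have "sets m = sets borel \<Longrightarrow> space m = UNIV"
    using sets_eq_imp_space_eq[of m borel] by simp
  then show ?thesis
    unfolding nonzero_finite_borel_measure_def finite_borel_measure_def by auto
qed

lemma space_finite_borel_measure: "finite_borel_measure m \<Longrightarrow> space m = UNIV"
  using sets_eq_imp_space_eq[of m borel] by (simp add: finite_borel_measure_def)

lemma fourier_transform_character: "fourier_transform m z = (\<integral>x. character z x \<partial>m)"
  unfolding fourier_transform_def character_def cis_conv_exp by (simp add: mult_ac)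

lemma norm_character [simp]: "norm (character z x) = 1"
  by (simp add: character_def)

lemma character_commute: "character z x = character x z"
  by (simp add: character_def inner_commute)

lemma fourier_transform_character': "fourier_transform m z = (\<integral>x. character x z \<partial>m)"
  using fourier_transform_character[of m z] character_commute[of z] by simp

lemma character_Pair: "character (z, w) (x, y) = character z x * character w y"
  by (simp add: character_def cis_mult algebra_simps)

lemma character_prod: "character (z, w) = (\<lambda>p. character z (fst p) * character w (snd p))"
  by (auto simp: character_Pair)

lemma character_diff: "character z (x - y) = character z x * cnj (character z y)"
  by (simp add: character_def cis_cnj cis_mult algebra_simps)

lemma continuous_character: "continuous_on UNIV (\<lambda>p. character (fst p) (snd p))"
  unfolding character_def by (intro continuous_intros)

lemma measurable_character [measurable]:
  assumes [measurable]: "f \<in> borel_measurable M" "g \<in> borel_measurable M"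
  shows "(\<lambda>x. character (f x) (g x)) \<in> borel_measurable M"
proof -
  have "(\<lambda>p. character (fst p) (snd p)) \<in> borel_measurable borel"
    by (rule borel_measurable_continuous_onI[OF continuous_character])
  from measurable_compose[OF borel_measurable_Pair[OF assms] this] show ?thesis
    by simp
qed

lemma measurable_character_right: "character z \<in> borel_measurable borel"
  by (rule measurable_character[OF borel_measurable_const measurable_ident_sets[OF refl]])

lemma measurable_cnj [measurable]: "cnj \<in> borel_measurable borel"
  by (intro borel_measurable_continuous_onI continuous_intros)

lemma norm_fourier_transform_le:
  "finite_borel_measure m \<Longrightarrow> norm (fourier_transform m z) \<le> measure m UNIV"
  unfolding fourier_transform_character
  by (rule integral_norm_bound[THEN order_trans]) (simp add: space_finite_borel_measure)

lemma measurable_fourier_transform: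
  assumes "finite_borel_measure m"
  shows "fourier_transform m \<in> borel_measurable borel"
proof -
  interpret finite_measure m using assms by (simp add: finite_borel_measure_def)
  have [measurable_cong]: "sets m = sets borel" using assms by (simp add: finite_borel_measure_def)
  show ?thesis
    unfolding fourier_transform_character[abs_def] by measurable
qed

text \<open>
  Both sides are the integral of the symmetric kernel \<^const>\<open>character\<close> against the product of
  the two measures.  This multiplication formula is the only form of Fourier inversion that the
  development uses: a measure whose transform is understood serves as a test object for the other.
\<close>

lemma fourier_multiplication_formula:
  assumes "finite_borel_measure m" "finite_borel_measure \<kappa>"
  shows "(\<integral>x. fourier_transform \<kappa> x \<partial>m) = (\<integral>z. fourier_transform m z \<partial>\<kappa>)"
proof -
  interpret m: finite_measure m using assms by (simp add: finite_borel_measure_def)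
  interpret k: finite_measure \<kappa> using assms by (simp add: finite_borel_measure_def)
  interpret pair_sigma_finite m \<kappa> ..
  interpret P: finite_measure "m \<Otimes>\<^sub>M \<kappa>" by (rule finite_measure_pair_measure) unfold_locales
  have [measurable_cong]: "sets m = sets borel" "sets \<kappa> = sets borel"
    using assms by (simp_all add: finite_borel_measure_def)
  have "integrable (m \<Otimes>\<^sub>M \<kappa>) (case_prod character)"
    by (rule P.integrable_const_bound[where B=1]) (auto simp: split_beta')
  from Fubini_integral[OF this] show ?thesis
    unfolding fourier_transform_character[abs_def] by (simp add: character_commute)
qed

lemma finite_borel_measure_pair:
  assumes "finite_borel_measure m" "finite_borel_measure n"
  shows "finite_borel_measure (m \<Otimes>\<^sub>M n)"
proof -
  interpret m: finite_measure m using assms by (simp add: finite_borel_measure_def)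
  interpret n: finite_measure n using assms by (simp add: finite_borel_measure_def)
  have "sets (m \<Otimes>\<^sub>M n) = sets borel"
    using sets_pair_measure_cong[of m borel n borel] assms
    by (simp add: finite_borel_measure_def borel_prod[symmetric])
  moreover have "finite_measure (m \<Otimes>\<^sub>M n)" by (rule finite_measure_pair_measure) unfold_locales
  ultimately show ?thesis by (simp add: finite_borel_measure_def)
qed

lemma finite_borel_measure_distr:
  fixes f :: "'a::euclidean_space \<Rightarrow> 'b::euclidean_space"
  assumes "finite_borel_measure m" "f \<in> borel_measurable borel"
  shows "finite_borel_measure (distr m borel f)"
  using assms unfolding finite_borel_measure_def
  by (auto intro!: finite_measure.finite_measure_distr simp: measurable_cong_sets[of m borel])

lemma fourier_transform_pair:
  fixes m :: "'a::euclidean_space measure" and n :: "'b::euclidean_space measure"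
  assumes "finite_borel_measure m" "finite_borel_measure n"
  shows "fourier_transform (m \<Otimes>\<^sub>M n) (z, w) = fourier_transform m z * fourier_transform n w"
proof -
  interpret m: finite_measure m using assms by (simp add: finite_borel_measure_def)
  interpret n: finite_measure n using assms by (simp add: finite_borel_measure_def)
  interpret pair_sigma_finite m n ..
  interpret P: finite_measure "m \<Otimes>\<^sub>M n" by (rule finite_measure_pair_measure) unfold_locales
  have [measurable_cong]: "sets m = sets borel" "sets n = sets borel"
    using assms by (simp_all add: finite_borel_measure_def)
  have int: "integrable (m \<Otimes>\<^sub>M n) (\<lambda>(x, y). character z x * character w y)"
    by (rule P.integrable_const_bound[where B=1]) (auto simp: split_beta' norm_mult)
  have "fourier_transform (m \<Otimes>\<^sub>M n) (z, w)
      = (\<integral>p. (case p of (x, y) \<Rightarrow> character z x * character w y) \<partial>(m \<Otimes>\<^sub>M n))"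
    unfolding fourier_transform_character
    by (intro Bochner_Integration.integral_cong) (auto simp: character_Pair)
  also have "\<dots> = (\<integral>x. (\<integral>y. character z x * character w y \<partial>n) \<partial>m)"
    using integral_fst[OF int] by simp
  also have "\<dots> = fourier_transform m z * fourier_transform n w"
    unfolding fourier_transform_character by simp
  finally show ?thesis .
qed

text \<open>
  Correlating a measure with itself turns its transform into the nonnegative function
  \<open>cmod (fourier_transform m z)\<^sup>2\<close>.  It serves twice: for Lebesgue measure on a small ball it yields
  positive test functions with compactly supported spectrum, and for the measure under study it
  measures how much mass sits on nearby pairs of points.
\<close>

definition autocorrelation :: "'a::euclidean_space measure \<Rightarrow> 'a measure" where
  "autocorrelation m = distr (m \<Otimes>\<^sub>M m) borel (\<lambda>(x, y). x - y)"

lemma finite_borel_measure_autocorrelation: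
  assumes "finite_borel_measure m"
  shows "finite_borel_measure (autocorrelation m)"
  unfolding autocorrelation_def
  by (intro finite_borel_measure_distr finite_borel_measure_pair assms)
     (simp add: split_beta' borel_prod[symmetric])

lemma measurable_diff_autocorrelation:
  assumes "finite_borel_measure m"
  shows "(\<lambda>(x, y). x - y) \<in> (m \<Otimes>\<^sub>M m) \<rightarrow>\<^sub>M borel"
proof -
  have [measurable_cong]: "sets m = sets borel" using assms by (simp add: finite_borel_measure_def)
  show ?thesis by measurable
qed

lemma fourier_transform_autocorrelation:
  assumes "finite_borel_measure m"
  shows "fourier_transform (autocorrelation m) z = of_real ((cmod (fourier_transform m z))\<^sup>2)"
proof -
  interpret m: finite_measure m using assms by (simp add: finite_borel_measure_def)
  interpret pair_sigma_finite m m ..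
  interpret P: finite_measure "m \<Otimes>\<^sub>M m" by (rule finite_measure_pair_measure) unfold_locales
  have [measurable_cong]: "sets m = sets borel"
    using assms by (simp_all add: finite_borel_measure_def)
  have int: "integrable (m \<Otimes>\<^sub>M m) (\<lambda>(x, y). character z x * cnj (character z y))"
    by (rule P.integrable_const_bound[where B=1]) (auto simp: split_beta' norm_mult)
  have "fourier_transform (autocorrelation m) z
      = (\<integral>p. (case p of (x, y) \<Rightarrow> character z x * cnj (character z y)) \<partial>(m \<Otimes>\<^sub>M m))"
    unfolding fourier_transform_character autocorrelation_def
    by (subst integral_distr[OF measurable_diff_autocorrelation[OF assms]])
       (auto simp: split_beta' character_diff)
  also have "\<dots> = (\<integral>x. (\<integral>y. character z x * cnj (character z y) \<partial>m) \<partial>m)"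
    using integral_fst[OF int] by simp
  also have "\<dots> = fourier_transform m z * cnj (fourier_transform m z)"
    unfolding fourier_transform_character by simp
  finally show ?thesis by (simp only: complex_norm_square)
qed

lemma nn_integral_autocorrelation:
  assumes "finite_borel_measure m" and h [measurable]: "h \<in> borel_measurable borel"
  shows "(\<integral>\<^sup>+z. h z \<partial>autocorrelation m) = (\<integral>\<^sup>+x. (\<integral>\<^sup>+y. h (x - y) \<partial>m) \<partial>m)"
proof -
  interpret m: finite_measure m using assms by (simp add: finite_borel_measure_def)
  have [measurable_cong]: "sets m = sets borel"
    using assms by (simp_all add: finite_borel_measure_def)
  show ?thesis
    unfolding autocorrelation_def
    by (subst nn_integral_distr[OF measurable_diff_autocorrelation[OF assms(1)]])
       (simp_all add: m.nn_integral_fst[symmetric])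
qed

section \<open>Supports\<close>

text \<open>
  The support was defined by neighbourhoods.  That it is contained in a closed set means that the
  complement is null, because the complement is a countable union of null open sets.
\<close>

lemma spt_subset_iff:
  fixes m :: "'a::euclidean_space measure"
  assumes "sets m = sets borel" "closed A"
  shows "spt m \<subseteq> A \<longleftrightarrow> emeasure m (- A) = 0"
proof
  assume spt: "spt m \<subseteq> A"
  define \<U> where "\<U> = {U. open U \<and> emeasure m U = 0}"
  obtain \<V> where V: "\<V> \<subseteq> \<U>" "countable \<V>" "\<Union>\<V> = \<Union>\<U>"
    using Lindelof[of \<U>] unfolding \<U>_def by (metis (no_types, lifting) mem_Collect_eq)
  have "- A \<subseteq> \<Union>\<V>"
  proof
    fix x assume "x \<in> - A"
    with spt obtain U where "open U" "x \<in> U" "\<not> emeasure m U > 0"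
      unfolding spt_def by blast
    then show "x \<in> \<Union>\<V>" unfolding V(3) \<U>_def by (auto simp: not_less)
  qed
  moreover have "(\<Union>U\<in>\<V>. U) \<in> null_sets m"
    using V(1,2) assms(1) by (intro null_sets_UN') (auto simp: \<U>_def null_sets_def)
  ultimately have "- A \<in> null_sets m"
    using assms by (intro null_sets_subset[of "\<Union>\<V>" m "- A"]) auto
  then show "emeasure m (- A) = 0" by auto
next
  assume null: "emeasure m (- A) = 0"
  show "spt m \<subseteq> A"
  proof
    fix x assume "x \<in> spt m"
    then have "x \<in> - A \<Longrightarrow> emeasure m (- A) > 0"
      using assms(2) unfolding spt_def by blast
    with null show "x \<in> A" by auto
  qed
qed

section \<open>Test measures with compact support and positive transform\<close>

lemma cball_borel [measurable, simp]: "cball (x::'a::euclidean_space) r \<in> sets borel"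
  by (simp add: borel_closed)

definition ball_measure :: "real \<Rightarrow> 'a::euclidean_space measure" where
  "ball_measure \<delta> = density lborel (\<lambda>x. ennreal (indicator (cball 0 \<delta>) x))"

lemma finite_borel_measure_ball_measure:
  "finite_borel_measure (ball_measure \<delta> :: 'a::euclidean_space measure)"
  unfolding finite_borel_measure_def
proof
  have "emeasure (ball_measure \<delta> :: 'a measure) (space (ball_measure \<delta>))
      = emeasure lborel (cball (0::'a) \<delta>)"
    unfolding ball_measure_def
    by (subst emeasure_density) (simp_all add: ennreal_indicator)
  then show "finite_measure (ball_measure \<delta> :: 'a measure)"
    using emeasure_compact_finite[OF compact_cball, of "0::'a" \<delta>]
    by (intro finite_measureI) auto
qed (simp add: ball_measure_def)

text \<open>
  At frequencies small compared with the reciprocal of the radius all phases stay within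
  \<open>\<pi> / 3\<close> of zero, so that nothing cancels.
\<close>

lemma fourier_transform_ball_measure_ge:
  fixes w :: "'a::euclidean_space"
  assumes "6 * \<delta> * norm w \<le> 1"
  shows "measure lborel (cball (0::'a) \<delta>) / 2 \<le> cmod (fourier_transform (ball_measure \<delta>) w)"
proof -
  let ?I = "indicator (cball (0::'a) \<delta>) :: 'a \<Rightarrow> real"
  have fin: "emeasure lborel (cball (0::'a) \<delta>) < \<infinity>"
    using emeasure_compact_finite[OF compact_cball] by auto
  have int: "integrable lborel (\<lambda>x. ?I x *\<^sub>R character w x)"
  proof (rule Bochner_Integration.integrable_bound[where f = ?I])
    show "(\<lambda>x. ?I x *\<^sub>R character w x) \<in> borel_measurable lborel" by measurable
  qed (use fin in auto)
  have "fourier_transform (ball_measure \<delta>) w = (\<integral>x. ?I x *\<^sub>R character w x \<partial>lborel)"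
    unfolding fourier_transform_character ball_measure_def
    by (rule integral_density) auto
  then have "Re (fourier_transform (ball_measure \<delta>) w)
      = (\<integral>x. Re (?I x *\<^sub>R character w x) \<partial>lborel)"
    by (simp only: integral_Re[OF int])
  also have "\<dots> \<ge> (\<integral>x. ?I x * (1/2) \<partial>lborel)"
  proof (rule integral_mono)
    fix x :: 'a
    show "?I x * (1/2) \<le> Re (?I x *\<^sub>R character w x)"
    proof (cases "x \<in> cball 0 \<delta>")
      case True
      then have x: "norm x \<le> \<delta>" by simp
      have "\<bar>w \<bullet> x\<bar> \<le> norm w * norm x" by (rule Cauchy_Schwarz_ineq2)
      also have "\<dots> \<le> norm w * \<delta>" using x by (intro mult_left_mono) auto
      also have "\<dots> \<le> 1 / 6" using assms by (simp add: mult_ac)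
      finally have "2 * pi * \<bar>w \<bullet> x\<bar> \<le> 2 * pi * (1 / 6)" by (intro mult_left_mono) auto
      then have "cos (pi / 3) \<le> cos (2 * pi * \<bar>w \<bullet> x\<bar>)"
        by (intro cos_monotone_0_pi_le) auto
      also have "\<dots> = cos (2 * pi * (w \<bullet> x))" by (cases "w \<bullet> x \<ge> 0") auto
      finally show ?thesis using True by (simp add: character_def cos_60)
    qed simp
  next
    show "integrable lborel (\<lambda>x. Re (?I x *\<^sub>R character w x))"
      by (intro integrable_Re int)
  qed (use fin in auto)
  also have "(\<integral>x. ?I x * (1/2) \<partial>lborel) = measure lborel (cball (0::'a) \<delta>) / 2"
    by simp
  finally show ?thesis using complex_Re_le_cmod[of "fourier_transform (ball_measure \<delta>) w"] by linarith
qed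

lemma nn_integral_lborel_reflect:
  fixes x :: "'a::euclidean_space"
  assumes [measurable]: "h \<in> borel_measurable borel"
  shows "(\<integral>\<^sup>+y. h (x - y) \<partial>lborel) = (\<integral>\<^sup>+y. h y \<partial>lborel)"
proof -
  have "lborel = density (distr lborel borel (\<lambda>y::'a. x + (-1) *\<^sub>R y)) (\<lambda>_. \<bar>- 1 :: real\<bar>^DIM('a))"
    by (rule lborel_affine) simp
  then have "lborel = distr lborel borel (\<lambda>y::'a. x - y)"
    by (simp add: density_1)
  then have "(\<integral>\<^sup>+y. h y \<partial>lborel) = (\<integral>\<^sup>+y. h y \<partial>distr lborel borel (\<lambda>y::'a. x - y))"
    by simp
  then show ?thesis by (simp add: nn_integral_distr)
qed

text \<open>
  The differences of two points of a ball lie in the ball of twice the radius and have a density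
  at most the volume of the ball.
\<close>

lemma nn_integral_autocorrelation_ball_le:
  fixes h :: "'a::euclidean_space \<Rightarrow> ennreal"
  assumes [measurable]: "h \<in> borel_measurable borel"
  shows "(\<integral>\<^sup>+z. h z \<partial>autocorrelation (ball_measure \<delta>))
    \<le> ennreal (measure lborel (cball (0::'a) \<delta>)) * (\<integral>\<^sup>+z\<in>cball 0 (2 * \<delta>). h z \<partial>lborel)"
proof -
  let ?J = "\<integral>\<^sup>+z\<in>cball 0 (2 * \<delta>). h z \<partial>lborel"
  let ?I = "indicator (cball (0::'a) \<delta>) :: 'a \<Rightarrow> ennreal"
  have ball: "(\<integral>\<^sup>+z. f z \<partial>ball_measure \<delta>) = (\<integral>\<^sup>+z. ?I z * f z \<partial>lborel)"
    if [measurable]: "f \<in> borel_measurable borel" for f :: "'a \<Rightarrow> ennreal"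
    unfolding ball_measure_def by (subst nn_integral_density) (auto simp: ennreal_indicator)
  have inner: "(\<integral>\<^sup>+y. ?I y * h (x - y) \<partial>lborel) \<le> ?J" if "x \<in> cball 0 \<delta>" for x
  proof -
    have "(\<integral>\<^sup>+y. ?I y * h (x - y) \<partial>lborel)
        \<le> (\<integral>\<^sup>+y. h (x - y) * indicator (cball 0 (2 * \<delta>)) (x - y) \<partial>lborel)"
    proof (rule nn_integral_mono)
      fix y
      have "norm y \<le> \<delta> \<Longrightarrow> norm (x - y) \<le> 2 * \<delta>"
        using that norm_triangle_ineq4[of x y] by simp
      then show "?I y * h (x - y) \<le> h (x - y) * indicator (cball 0 (2 * \<delta>)) (x - y)"
        by (auto simp: indicator_def)
    qed
    also have "\<dots> = ?J" by (rule nn_integral_lborel_reflect) measurable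
    finally show ?thesis .
  qed
  interpret L: finite_measure "ball_measure \<delta> :: 'a measure"
    using finite_borel_measure_ball_measure by (auto simp: finite_borel_measure_def)
  have [measurable_cong]: "sets (ball_measure \<delta> :: 'a measure) = sets borel"
    by (simp add: ball_measure_def)
  have "(\<integral>\<^sup>+z. h z \<partial>autocorrelation (ball_measure \<delta>))
      = (\<integral>\<^sup>+x. ?I x * (\<integral>\<^sup>+y. ?I y * h (x - y) \<partial>lborel) \<partial>lborel)"
    unfolding nn_integral_autocorrelation[OF finite_borel_measure_ball_measure assms]
    by (simp add: ball)
  also have "\<dots> \<le> (\<integral>\<^sup>+x. ?I x * ?J \<partial>lborel)"
    by (intro nn_integral_mono) (use inner in \<open>auto split: split_indicator\<close>)
  also have "\<dots> = emeasure lborel (cball (0::'a) \<delta>) * ?J"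
    by (simp add: nn_integral_multc)
  also have "emeasure lborel (cball (0::'a) \<delta>) = ennreal (measure lborel (cball (0::'a) \<delta>))"
    using emeasure_compact_finite[OF compact_cball, of "0::'a" \<delta>]
    by (intro emeasure_eq_ennreal_measure) auto
  finally show ?thesis .
qed

section \<open>Power means\<close>

lemma bernoulli_powr:
  fixes x p :: real
  assumes "0 \<le> x" "1 \<le> p"
  shows "1 + p * (x - 1) \<le> x powr p"
proof (cases "x = 0")
  case False
  have "((\<lambda>x. x powr p) has_real_derivative p) (at 1 within {0<..})"
    by (auto intro!: derivative_eq_intros)
  then have "p * (x - 1) \<le> x powr p - 1 powr p"
    using assms False
    by (intro convex_on_imp_above_tangent[OF powr_convex]) (auto simp: interior_open)
  then show ?thesis by simp
qed (use assms in auto)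

text \<open>
  Jensen's inequality for a power, obtained by integrating the tangent at the mean.
\<close>

lemma power_mean_le:
  fixes h :: "'a \<Rightarrow> real"
  assumes "finite_measure M" and [measurable]: "h \<in> borel_measurable M"
    and h: "\<And>x. 0 \<le> h x" "\<And>x. h x \<le> B" and p: "1 \<le> p"
  shows "(\<integral>x. h x \<partial>M) powr p \<le> measure M (space M) powr (p - 1) * (\<integral>x. h x powr p \<partial>M)"
proof (cases "(\<integral>x. h x \<partial>M) = 0")
  case True
  then show ?thesis by (simp add: Bochner_Integration.integral_nonneg)
next
  case False
  interpret finite_measure M by fact
  let ?V = "measure M (space M)" and ?S = "\<integral>x. h x \<partial>M"
  have int: "integrable M h"
    by (rule integrable_const_bound[where B=B]) (use h in auto)
  have intp: "integrable M (\<lambda>x. h x powr p)"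
    by (rule integrable_const_bound[where B="B powr p"]) (use h p in \<open>auto intro!: AE_I2 powr_mono2\<close>)
  have S: "?S > 0" using False Bochner_Integration.integral_nonneg[of M h] h by (simp add: less_le)
  have V: "?V > 0"
  proof (rule ccontr)
    assume "\<not> ?V > 0"
    then have "?V = 0" using measure_nonneg[of M "space M"] by linarith
    moreover have "?S \<le> (\<integral>x. B \<partial>M)" by (intro integral_mono int) (use h in auto)
    ultimately show False using S by simp
  qed
  define A where "A = ?S / ?V"
  have A: "A > 0" using S V by (simp add: A_def)
  have "(\<integral>x. 1 + p * (h x / A - 1) \<partial>M) \<le> (\<integral>x. h x powr p / A powr p \<partial>M)"
  proof (rule integral_mono)
    show "1 + p * (h x / A - 1) \<le> h x powr p / A powr p" for x
      using bernoulli_powr[of "h x / A" p] h A p by (simp add: powr_divide)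
  qed (use int intp in auto)
  also have "(\<integral>x. 1 + p * (h x / A - 1) \<partial>M) = ?V + p * (?S / A - ?V)"
    using int by simp
  also have "\<dots> = ?V" using S V by (simp add: A_def)
  finally have *: "?V * A powr p \<le> (\<integral>x. h x powr p \<partial>M)"
    using A by (simp add: field_simps)
  have "?S powr p = ?V powr p * A powr p"
    using V A by (simp add: A_def flip: powr_mult)
  also have "\<dots> = ?V powr (p - 1) * (?V * A powr p)"
    using V by (simp add: powr_diff)
  also have "\<dots> \<le> ?V powr (p - 1) * (\<integral>x. h x powr p \<partial>M)"
    using * by (intro mult_left_mono) auto
  finally show ?thesis .
qed

section \<open>Projecting measures on a product to a factor\<close>

text \<open>
  Restricting the transform of a measure to a slice gives the transform of a projection, but a
  single slice is a null set for the integrals that define the energy.  Weighting the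
  measure with the transform of \<open>\<kappa>\<close> before projecting replaces the slice by an
  average over slices.
\<close>

definition weighted_projection ::
  "('a::euclidean_space \<times> 'b::euclidean_space) measure \<Rightarrow> 'a measure \<Rightarrow> 'b measure" where
  "weighted_projection m \<kappa> =
     distr (density m (\<lambda>p. ennreal (Re (fourier_transform \<kappa> (fst p))))) borel snd"

lemma sets_finite_borel_measure_prod:
  "finite_borel_measure m \<Longrightarrow> sets m = sets (borel \<Otimes>\<^sub>M borel)"
  unfolding finite_borel_measure_def borel_prod by simp

context
  fixes m :: "('a::euclidean_space \<times> 'b::euclidean_space) measure" and \<kappa> :: "'a measure"
  assumes m: "finite_borel_measure m" and \<kappa>: "finite_borel_measure \<kappa>"
    and real_nonneg: "\<And>w. fourier_transform \<kappa> w \<in> \<real>\<^sub>\<ge>\<^sub>0"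
begin

private lemma measurable_weight [measurable]:
  "(\<lambda>p. Re (fourier_transform \<kappa> (fst p))) \<in> borel_measurable m"
proof -
  note [measurable_cong] = sets_finite_borel_measure_prod[OF m]
  note [measurable] = measurable_fourier_transform[OF \<kappa>]
  show ?thesis by measurable
qed

private lemma measurable_snd_density [measurable]:
  "snd \<in> density m (\<lambda>p. ennreal (Re (fourier_transform \<kappa> (fst p)))) \<rightarrow>\<^sub>M borel"
proof -
  note [measurable_cong] = sets_finite_borel_measure_prod[OF m]
  show ?thesis by measurable
qed

lemma emeasure_weighted_projection:
  assumes "B \<in> sets borel"
  shows "emeasure (weighted_projection m \<kappa>) B
    = (\<integral>\<^sup>+p. ennreal (Re (fourier_transform \<kappa> (fst p))) * indicator (UNIV \<times> B) p \<partial>m)"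
proof -
  have sm: "sets m = sets borel" using m by (simp add: finite_borel_measure_def)
  have B: "UNIV \<times> B \<in> sets m"
    using assms unfolding sm borel_prod[symmetric] by (intro pair_measureI) auto
  have "snd -` B \<inter> space m = UNIV \<times> B"
    using space_finite_borel_measure[OF m] by auto
  then show ?thesis
    unfolding weighted_projection_def using assms B
    by (subst emeasure_distr) (auto simp: emeasure_density)
qed

lemma finite_borel_measure_weighted_projection:
  "finite_borel_measure (weighted_projection m \<kappa>)"
proof -
  interpret finite_measure m using m by (simp add: finite_borel_measure_def)
  let ?\<nu> = "weighted_projection m \<kappa>"
  have "emeasure ?\<nu> (space ?\<nu>)
      = (\<integral>\<^sup>+p. ennreal (Re (fourier_transform \<kappa> (fst p))) * indicator (UNIV \<times> UNIV) p \<partial>m)"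
    using emeasure_weighted_projection[of UNIV] by (simp add: weighted_projection_def)
  also have "\<dots> \<le> (\<integral>\<^sup>+p. ennreal (measure \<kappa> UNIV) \<partial>m)"
    using norm_fourier_transform_le[OF \<kappa>] complex_Re_le_cmod order_trans
    by (intro nn_integral_mono) (simp, blast intro: ennreal_leI order_trans)
  also have "\<dots> < \<infinity>"
    by (simp add: ennreal_mult_less_top emeasure_eq_measure)
  finally show ?thesis
    unfolding finite_borel_measure_def
    by (auto intro!: finite_measureI simp: weighted_projection_def)
qed

lemma fourier_transform_weighted_projection:
  "fourier_transform (weighted_projection m \<kappa>) y = (\<integral>\<xi>. fourier_transform m (\<xi>, y) \<partial>\<kappa>)"
proof -
  interpret m: finite_measure m using m by (simp add: finite_borel_measure_def)
  interpret k: finite_measure \<kappa> using \<kappa> by (simp add: finite_borel_measure_def)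
  interpret pair_sigma_finite m \<kappa> ..
  interpret P: finite_measure "m \<Otimes>\<^sub>M \<kappa>" by (rule finite_measure_pair_measure) unfold_locales
  note [measurable_cong] = sets_finite_borel_measure_prod[OF m]
  have [measurable_cong]: "sets \<kappa> = sets borel"
    using \<kappa> by (simp add: finite_borel_measure_def)
  have Re: "complex_of_real (Re (fourier_transform \<kappa> w)) = fourier_transform \<kappa> w" for w
    using real_nonneg[of w] by (simp add: nonneg_Reals_subset_Reals[THEN subsetD] of_real_Re)
  have Re_nonneg: "0 \<le> Re (fourier_transform \<kappa> w)" for w
    using real_nonneg[of w] by (auto simp: nonneg_Reals_def)
  have int: "integrable (m \<Otimes>\<^sub>M \<kappa>) (\<lambda>(p, \<xi>). character \<xi> (fst p) * character y (snd p))"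
    by (rule P.integrable_const_bound[where B=1]) (auto simp: split_beta' norm_mult)
  have "fourier_transform (weighted_projection m \<kappa>) y
     = (\<integral>v. character y v \<partial>weighted_projection m \<kappa>)"
    by (rule fourier_transform_character)
  also have "\<dots> = (\<integral>p. Re (fourier_transform \<kappa> (fst p)) *\<^sub>R character y (snd p) \<partial>m)"
    unfolding weighted_projection_def
    using Re_nonneg
    by (subst integral_distr, measurable) (subst integral_density, auto)
  also have "\<dots> = (\<integral>p. fourier_transform \<kappa> (fst p) * character y (snd p) \<partial>m)"
    by (simp add: scaleR_conv_of_real Re)
  also have "\<dots> = (\<integral>p. (\<integral>\<xi>. character \<xi> (fst p) * character y (snd p) \<partial>\<kappa>) \<partial>m)"
    unfolding fourier_transform_character' by simp
  also have "\<dots> = (\<integral>\<xi>. (\<integral>p. character \<xi> (fst p) * character y (snd p) \<partial>m) \<partial>\<kappa>)"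
    using Fubini_integral[OF int] by simp
  also have "\<dots> = (\<integral>\<xi>. fourier_transform m (\<xi>, y) \<partial>\<kappa>)"
    unfolding fourier_transform_character by (simp add: character_prod)
  finally show ?thesis .
qed

lemma powr_fourier_transform_weighted_projection_le:
  assumes "1 \<le> p"
  shows "ennreal (cmod (fourier_transform (weighted_projection m \<kappa>) y) powr p)
    \<le> ennreal (measure \<kappa> UNIV powr (p - 1))
        * (\<integral>\<^sup>+\<xi>. ennreal (cmod (fourier_transform m (\<xi>, y)) powr p) \<partial>\<kappa>)"
proof -
  interpret k: finite_measure \<kappa> using \<kappa> by (simp add: finite_borel_measure_def)
  have [measurable_cong]: "sets \<kappa> = sets borel"
    using \<kappa> by (simp add: finite_borel_measure_def)
  have "fourier_transform m \<in> borel_measurable (borel \<Otimes>\<^sub>M borel)"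
    using measurable_fourier_transform[OF m] by (simp add: borel_prod)
  note [measurable] = this
  let ?h = "\<lambda>\<xi>. cmod (fourier_transform m (\<xi>, y))"
  have "cmod (fourier_transform (weighted_projection m \<kappa>) y) powr p \<le> (\<integral>\<xi>. ?h \<xi> \<partial>\<kappa>) powr p"
    unfolding fourier_transform_weighted_projection
    using assms by (intro powr_mono2 integral_norm_bound) auto
  also have "\<dots> \<le> measure \<kappa> (space \<kappa>) powr (p - 1) * (\<integral>\<xi>. ?h \<xi> powr p \<partial>\<kappa>)"
    using norm_fourier_transform_le[OF m] assms
    by (intro power_mean_le[where B = "measure m UNIV"]) (auto intro: k.finite_measure_axioms)
  finally have "ennreal (cmod (fourier_transform (weighted_projection m \<kappa>) y) powr p)
      \<le> ennreal (measure \<kappa> UNIV powr (p - 1)) * ennreal (\<integral>\<xi>. ?h \<xi> powr p \<partial>\<kappa>)"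
    by (simp add: space_finite_borel_measure[OF \<kappa>] ennreal_leI flip: ennreal_mult')
  also have "ennreal (\<integral>\<xi>. ?h \<xi> powr p \<partial>\<kappa>) = (\<integral>\<^sup>+\<xi>. ennreal (?h \<xi> powr p) \<partial>\<kappa>)"
  proof (rule nn_integral_eq_integral[symmetric])
    show "integrable \<kappa> (\<lambda>\<xi>. ?h \<xi> powr p)"
      by (rule k.integrable_const_bound[where B="measure m UNIV powr p"])
         (use norm_fourier_transform_le[OF m] assms in \<open>auto intro!: AE_I2 powr_mono2\<close>)
  qed auto
  finally show ?thesis .
qed

end

text \<open>
  The weight is the transform of the autocorrelation of Lebesgue measure on a ball so small that
  it stays positive on the bounded set \<open>X\<close>, so the projection does not vanish.
\<close>

lemma exists_projection:
  fixes X :: "'a::euclidean_space set" and Y :: "'b::euclidean_space set"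
  assumes X: "compact X" and Y: "compact Y"
    and m: "nonzero_finite_borel_measure m" and spt: "spt m \<subseteq> X \<times> Y"
  obtains \<nu> \<kappa> C where
    "nonzero_finite_borel_measure \<nu>" "spt \<nu> \<subseteq> Y" "finite_borel_measure \<kappa>"
    "\<And>h::'a \<Rightarrow> ennreal. h \<in> borel_measurable borel \<Longrightarrow>
       (\<integral>\<^sup>+\<xi>. h \<xi> \<partial>\<kappa>) \<le> ennreal C * (\<integral>\<^sup>+\<xi>\<in>cball 0 1. h \<xi> \<partial>lborel)"
    "\<And>p y. 1 \<le> p \<Longrightarrow> ennreal (cmod (fourier_transform \<nu> y) powr p)
       \<le> ennreal (measure \<kappa> UNIV powr (p - 1))
        * (\<integral>\<^sup>+\<xi>. ennreal (cmod (fourier_transform m (\<xi>, y)) powr p) \<partial>\<kappa>)"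
proof -
  obtain R where R: "R > 0" "\<And>x. x \<in> X \<Longrightarrow> norm x \<le> R"
    using compact_imp_bounded[OF X] unfolding bounded_pos by blast
  define \<delta> where "\<delta> = min (1/2) (1 / (6 * R))"
  have \<delta>: "0 < \<delta>" "\<delta> \<le> 1/2" "6 * \<delta> * R \<le> 1"
    using R(1) by (auto simp: \<delta>_def min_def field_simps)
  let ?B = "ball_measure \<delta> :: 'a measure"
  define \<kappa> where "\<kappa> = autocorrelation ?B"
  define \<nu> where "\<nu> = weighted_projection m \<kappa>"
  have m': "finite_borel_measure m" and mnz: "emeasure m UNIV \<noteq> 0"
    using m by (simp_all add: nonzero_finite_borel_measure_iff)
  have sm: "sets m = sets borel" using m' by (simp add: finite_borel_measure_def)
  have \<kappa>: "finite_borel_measure \<kappa>"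
    unfolding \<kappa>_def by (intro finite_borel_measure_autocorrelation finite_borel_measure_ball_measure)
  have ft: "fourier_transform \<kappa> w = of_real ((cmod (fourier_transform ?B w))\<^sup>2)" for w
    unfolding \<kappa>_def
    by (intro fourier_transform_autocorrelation finite_borel_measure_ball_measure)
  have nn: "fourier_transform \<kappa> w \<in> \<real>\<^sub>\<ge>\<^sub>0" for w
    unfolding ft by (simp del: of_real_power)
  have pos: "Re (fourier_transform \<kappa> w) > 0" if "w \<in> X" for w
  proof -
    have "6 * \<delta> * norm w \<le> 6 * \<delta> * R"
      using R(2)[OF that] \<delta> by (intro mult_left_mono) auto
    then have "measure lborel (cball (0::'a) \<delta>) / 2 \<le> cmod (fourier_transform ?B w)"
      using \<delta> by (intro fourier_transform_ball_measure_ge) linarith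
    moreover have "measure lborel (cball (0::'a) \<delta>) > 0"
      using \<delta> by (intro content_cball_pos)
    ultimately have "cmod (fourier_transform ?B w) > 0" by linarith
    then show ?thesis unfolding ft by (simp del: of_real_power)
  qed
  have closed: "closed X" "closed Y" "closed (X \<times> Y)"
    using X Y by (auto intro: compact_imp_closed compact_Times)
  have AE: "AE p in m. p \<in> X \<times> Y"
    using spt_subset_iff[OF sm closed(3)] spt closed(3)
    by (intro AE_I[of _ _ "- (X \<times> Y)"]) (auto simp: sm)
  have "emeasure \<nu> UNIV \<noteq> 0"
  proof
    assume "emeasure \<nu> UNIV = 0"
    then have "(\<integral>\<^sup>+p. ennreal (Re (fourier_transform \<kappa> (fst p))) \<partial>m) = 0"
      using emeasure_weighted_projection[OF m' \<kappa> nn, of UNIV] by (simp add: \<nu>_def)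
    moreover have "(\<lambda>p. ennreal (Re (fourier_transform \<kappa> (fst p)))) \<in> borel_measurable m"
      using measurable_fourier_transform[OF \<kappa>]
      by (simp add: measurable_cong_sets[OF sm refl] borel_prod[symmetric])
    ultimately have "AE p in m. ennreal (Re (fourier_transform \<kappa> (fst p))) = 0"
      by (simp add: nn_integral_0_iff_AE)
    with AE have "AE p in m. False"
    proof eventually_elim
      case (elim p)
      then show ?case using pos[of "fst p"] by (auto simp: ennreal_eq_0_iff)
    qed
    then have "emeasure m (space m) = 0" by (simp add: AE_iff_measurable[OF _ refl] ae_filter_eq_bot_iff trivial_limit_def)
    then show False using mnz space_finite_borel_measure[OF m'] by simp
  qed
  moreover have "finite_borel_measure \<nu>"
    unfolding \<nu>_def by (intro finite_borel_measure_weighted_projection m' \<kappa> nn)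
  ultimately have 1: "nonzero_finite_borel_measure \<nu>"
    by (simp add: nonzero_finite_borel_measure_iff)
  have "emeasure \<nu> (- Y)
      = (\<integral>\<^sup>+p. ennreal (Re (fourier_transform \<kappa> (fst p))) * indicator (UNIV \<times> - Y) p \<partial>m)"
    unfolding \<nu>_def using closed by (subst emeasure_weighted_projection[OF m' \<kappa> nn]) auto
  also have "\<dots> = (\<integral>\<^sup>+p. 0 \<partial>m)"
    by (rule nn_integral_cong_AE) (use AE in eventually_elim, auto split: split_indicator)
  finally have "emeasure \<nu> (- Y) = 0" by simp
  then have 2: "spt \<nu> \<subseteq> Y"
    by (subst spt_subset_iff) (auto simp: \<nu>_def weighted_projection_def closed)
  have 3: "(\<integral>\<^sup>+\<xi>. h \<xi> \<partial>\<kappa>)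
      \<le> ennreal (measure lborel (cball (0::'a) \<delta>)) * (\<integral>\<^sup>+\<xi>\<in>cball 0 1. h \<xi> \<partial>lborel)"
    if [measurable]: "h \<in> borel_measurable borel" for h :: "'a \<Rightarrow> ennreal"
  proof -
    have "(\<integral>\<^sup>+\<xi>. h \<xi> \<partial>\<kappa>)
        \<le> ennreal (measure lborel (cball (0::'a) \<delta>)) * (\<integral>\<^sup>+\<xi>\<in>cball 0 (2*\<delta>). h \<xi> \<partial>lborel)"
      unfolding \<kappa>_def by (rule nn_integral_autocorrelation_ball_le) fact
    also have "\<dots> \<le> ennreal (measure lborel (cball (0::'a) \<delta>)) * (\<integral>\<^sup>+\<xi>\<in>cball 0 1. h \<xi> \<partial>lborel)"
      using \<delta> by (intro mult_left_mono nn_integral_mono) (auto split: split_indicator)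
    finally show ?thesis .
  qed
  show thesis
    by (rule that[OF 1 2 \<kappa> 3])
       (auto simp: \<nu>_def intro: powr_fourier_transform_weighted_projection_le[OF m' \<kappa> nn])
qed

section \<open>Integrability of powers of the norm\<close>

lemma le_suminf_ennreal: "f j \<le> suminf f" for f :: "nat \<Rightarrow> ennreal"
  using sum_le_suminf[of f "{j}"] by simp

text \<open>
  Dyadic decomposition: on the shell \<open>norm x \<approx> 2 powr (\<sigma> * j)\<close> the integrand times the volume is of
  the order \<open>2 powr (- e * j)\<close>.  The sign \<open>\<sigma>\<close> selects the unit ball or its complement.
\<close>

lemma nn_integral_norm_powr_dyadic:
  fixes \<sigma> e :: real
  assumes \<sigma>: "\<sigma> = 1 \<or> \<sigma> = -1" and e: "e > 0"
  shows "(\<integral>\<^sup>+x::'a::euclidean_space\<in>{x. x \<noteq> 0 \<and> 0 \<le> \<sigma> * log 2 (norm x)}.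
           ennreal (norm x powr (- \<sigma> * e - real DIM('a))) \<partial>lborel) < \<infinity>"
proof -
  let ?n = "real DIM('a)"
  define q where "q = - \<sigma> * e - ?n"
  define V where "V = unit_ball_vol (real DIM('a))"
  define c where "c j = 2 powr (\<bar>q\<bar> + \<sigma> * real j * q)" for j
  define r where "r j = 2 powr (\<sigma> * real j + 1)" for j
  have \<sigma>2: "\<sigma> * \<sigma> = 1" "\<bar>\<sigma>\<bar> = 1" using \<sigma> by auto
  have "(\<integral>\<^sup>+x::'a\<in>{x. x \<noteq> 0 \<and> 0 \<le> \<sigma> * log 2 (norm x)}. ennreal (norm x powr q) \<partial>lborel)
      \<le> (\<integral>\<^sup>+(x::'a). (\<Sum>j. ennreal (c j) * indicator (cball 0 (r j)) x) \<partial>lborel)"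
  proof (rule nn_integral_mono)
    fix x :: 'a
    show "ennreal (norm x powr q) * indicator {x. x \<noteq> 0 \<and> 0 \<le> \<sigma> * log 2 (norm x)} x
        \<le> (\<Sum>j. ennreal (c j) * indicator (cball 0 (r j)) x)"
    proof (cases "x \<noteq> 0 \<and> 0 \<le> \<sigma> * log 2 (norm x)")
      case True
      define L where "L = log 2 (norm x)"
      define j where "j = nat \<lfloor>\<sigma> * L\<rfloor>"
      have x: "norm x = 2 powr L" using True by (simp add: L_def)
      have "real j \<le> \<sigma> * L" "\<sigma> * L \<le> real j + 1"
        using True unfolding j_def L_def by linarith+
      then have "\<bar>\<sigma> * L - real j\<bar> \<le> 1" by linarith
      moreover have "L - \<sigma> * real j = \<sigma> * (\<sigma> * L - real j)"
        using \<sigma>2 by (simp add: algebra_simps flip: mult.assoc)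
      ultimately have d: "\<bar>L - \<sigma> * real j\<bar> \<le> 1" using \<sigma>2 by (simp add: abs_mult)
      then have "\<bar>(L - \<sigma> * real j) * q\<bar> \<le> 1 * \<bar>q\<bar>"
        unfolding abs_mult by (intro mult_right_mono) auto
      then have "L * q \<le> \<bar>q\<bar> + \<sigma> * real j * q"
        by (simp add: algebra_simps abs_le_iff)
      then have "norm x powr q \<le> c j"
        unfolding x c_def by (simp add: powr_powr)
      moreover have "norm x \<le> r j"
        unfolding x r_def using d by simp
      ultimately have "ennreal (norm x powr q) \<le> ennreal (c j) * indicator (cball 0 (r j)) x"
        by (simp add: ennreal_leI)
      also have "\<dots> \<le> (\<Sum>j. ennreal (c j) * indicator (cball 0 (r j)) x)"
        by (rule le_suminf_ennreal)
      finally show ?thesis using True by simp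
    qed auto
  qed
  also have "\<dots> = (\<Sum>j. ennreal (c j) * emeasure lborel (cball (0::'a) (r j)))"
    by (subst nn_integral_suminf) (auto simp: nn_integral_cmult)
  also have "\<dots> = (\<Sum>j. ennreal (2 powr (\<bar>q\<bar> + ?n) * V * (2 powr - e) ^ j))"
  proof (intro suminf_cong)
    fix j
    have "r j ^ DIM('a) = 2 powr ((\<sigma> * real j + 1) * ?n)"
      unfolding r_def by (simp add: powr_powr flip: powr_realpow)
    moreover have "(2 powr - e) ^ j = 2 powr (- e * real j)"
      by (simp add: powr_powr flip: powr_realpow)
    moreover have "\<bar>q\<bar> + \<sigma> * real j * q + (\<sigma> * real j + 1) * ?n = \<bar>q\<bar> + ?n + - e * real j"
    proof -
      have "\<sigma> * real j * q + (\<sigma> * real j + 1) * ?n = - (\<sigma> * \<sigma>) * e * real j + ?n"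
        unfolding q_def by (simp add: algebra_simps)
      then show ?thesis using \<sigma>2 by simp
    qed
    then have "c j * 2 powr ((\<sigma> * real j + 1) * ?n) = 2 powr (\<bar>q\<bar> + ?n) * 2 powr (- e * real j)"
      unfolding c_def powr_add[symmetric] by (rule arg_cong)
    ultimately have "c j * (V * r j ^ DIM('a)) = 2 powr (\<bar>q\<bar> + ?n) * V * (2 powr - e) ^ j"
      by (simp only: mult_ac)
    then show "ennreal (c j) * emeasure lborel (cball (0::'a) (r j))
        = ennreal (2 powr (\<bar>q\<bar> + ?n) * V * (2 powr - e) ^ j)"
      by (simp add: emeasure_cball r_def V_def c_def flip: ennreal_mult')
  qed
  also have "\<dots> < \<infinity>"
  proof -
    have "summable (\<lambda>j. 2 powr (\<bar>q\<bar> + ?n) * V * (2 powr - e) ^ j)"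
      using e by (intro summable_mult summable_geometric)
        (auto simp: powr_minus_divide divide_less_eq)
    then have "(\<Sum>j. ennreal (2 powr (\<bar>q\<bar> + ?n) * V * (2 powr - e) ^ j)) \<noteq> top"
      by (rule ennreal_suminf_neq_top) (simp add: V_def)
    then show ?thesis by (simp add: top.not_eq_extremum)
  qed
  finally show ?thesis unfolding q_def .
qed

lemma nn_integral_norm_powr_ball:
  assumes "e > 0"
  shows "(\<integral>\<^sup>+x::'a::euclidean_space\<in>cball 0 1. ennreal (norm x powr (e - real DIM('a))) \<partial>lborel) < \<infinity>"
proof -
  have "(\<integral>\<^sup>+x::'a\<in>cball 0 1. ennreal (norm x powr (e - real DIM('a))) \<partial>lborel)
     \<le> (\<integral>\<^sup>+x::'a\<in>{x. x \<noteq> 0 \<and> 0 \<le> -1 * log 2 (norm x)}.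
           ennreal (norm x powr (- (-1) * e - real DIM('a))) \<partial>lborel)"
  proof (rule nn_integral_mono)
    fix x :: 'a
    have "x \<noteq> 0 \<Longrightarrow> norm x > 0" by simp
    then show "ennreal (norm x powr (e - real DIM('a))) * indicator (cball 0 1) x
        \<le> ennreal (norm x powr (- (-1) * e - real DIM('a)))
            * indicator {x. x \<noteq> 0 \<and> 0 \<le> -1 * log 2 (norm x)} x"
      by (cases "x = 0") (auto split: split_indicator)
  qed
  also have "\<dots> < \<infinity>" using assms by (intro nn_integral_norm_powr_dyadic) auto
  finally show ?thesis .
qed

lemma nn_integral_norm_powr_outside:
  assumes "e > 0"
  shows "(\<integral>\<^sup>+x::'a::euclidean_space\<in>- ball 0 1. ennreal (norm x powr (- e - real DIM('a))) \<partial>lborel) < \<infinity>"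
proof -
  have "(\<integral>\<^sup>+x::'a\<in>- ball 0 1. ennreal (norm x powr (- e - real DIM('a))) \<partial>lborel)
     \<le> (\<integral>\<^sup>+x::'a\<in>{x. x \<noteq> 0 \<and> 0 \<le> 1 * log 2 (norm x)}.
           ennreal (norm x powr (- 1 * e - real DIM('a))) \<partial>lborel)"
  proof (rule nn_integral_mono)
    fix x :: 'a
    have "x \<noteq> 0 \<Longrightarrow> norm x > 0" by simp
    then show "ennreal (norm x powr (- e - real DIM('a))) * indicator (- ball 0 1) x
        \<le> ennreal (norm x powr (- 1 * e - real DIM('a)))
            * indicator {x. x \<noteq> 0 \<and> 0 \<le> 1 * log 2 (norm x)} x"
      by (cases "x = 0") (auto split: split_indicator)
  qed
  also have "\<dots> < \<infinity>" using assms by (intro nn_integral_norm_powr_dyadic) auto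
  finally show ?thesis .
qed

section \<open>Energies\<close>

lemma energy_finite_iff:
  fixes m :: "'a::euclidean_space measure"
  assumes "\<theta> > 0"
  shows "energy s \<theta> m < \<infinity> \<longleftrightarrow>
    (\<integral>\<^sup>+z. ennreal (cmod (fourier_transform m z) powr (2 / \<theta>)
        * norm z powr (s / \<theta> - real DIM('a))) \<partial>lborel) < \<infinity>"
  using assms by (simp add: energy_def ennreal_powr_def top.not_eq_extremum)

lemma energy_0_finite_iff:
  "energy s 0 m < \<infinity> \<longleftrightarrow> (\<exists>C. \<forall>z. (cmod (fourier_transform m z))\<^sup>2 * norm z powr s \<le> C)"
proof
  let ?f = "\<lambda>z. (cmod (fourier_transform m z))\<^sup>2 * norm z powr s"
  assume fin: "energy s 0 m < \<infinity>"
  have "?f z \<le> enn2real (energy s 0 m)" for z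
  proof -
    have "ennreal (?f z) \<le> energy s 0 m" unfolding energy_def by (auto intro: SUP_upper)
    then have "enn2real (ennreal (?f z)) \<le> enn2real (energy s 0 m)"
      using fin by (intro enn2real_mono) auto
    then show ?thesis by simp
  qed
  then show "\<exists>C. \<forall>z. ?f z \<le> C" by blast
next
  let ?f = "\<lambda>z. (cmod (fourier_transform m z))\<^sup>2 * norm z powr s"
  assume "\<exists>C. \<forall>z. ?f z \<le> C"
  then obtain C where "\<And>z. ?f z \<le> C" by blast
  then have "energy s 0 m \<le> ennreal C"
    unfolding energy_def by (auto intro!: SUP_least ennreal_leI)
  then show "energy s 0 m < \<infinity>" by (rule order.strict_trans1) simp
qed

text \<open>
  For the proof of the lower bounds the two ends of the energy integral must be treated separately:
  near the origin only boundedness of the transform is used, while decay matters at infinity.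
\<close>

definition partial_energy :: "real \<Rightarrow> real \<Rightarrow> 'a::euclidean_space measure \<Rightarrow> 'a set \<Rightarrow> ennreal" where
  "partial_energy p a m S =
     (\<integral>\<^sup>+z\<in>S. ennreal (cmod (fourier_transform m z) powr p * norm z powr (a - real DIM('a))) \<partial>lborel)"

lemma energy_finite_iff_partial:
  "\<theta> > 0 \<Longrightarrow> (energy s \<theta> m < \<infinity>) = (partial_energy (2 / \<theta>) (s / \<theta>) m UNIV < \<infinity>)"
  unfolding energy_finite_iff partial_energy_def by simp

lemma partial_energy_mono_bounded:
  fixes m :: "'a::euclidean_space measure"
  assumes m: "finite_borel_measure m" and "p \<ge> 0" and [measurable]: "S \<in> sets borel"
  shows "partial_energy p a m S
    \<le> ennreal (measure m UNIV powr p) * (\<integral>\<^sup>+z\<in>S. ennreal (norm z powr (a - real DIM('a))) \<partial>lborel)"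
proof -
  have "partial_energy p a m S
    \<le> (\<integral>\<^sup>+z. ennreal (measure m UNIV powr p) *
         (ennreal (norm z powr (a - real DIM('a))) * indicator S z) \<partial>lborel)"
    unfolding partial_energy_def using norm_fourier_transform_le[OF m] \<open>p \<ge> 0\<close>
    by (intro nn_integral_mono)
       (auto simp flip: ennreal_mult' intro!: ennreal_leI mult_right_mono powr_mono2
          split: split_indicator)
  also have "\<dots> = ennreal (measure m UNIV powr p) *
      (\<integral>\<^sup>+z\<in>S. ennreal (norm z powr (a - real DIM('a))) \<partial>lborel)"
    by (rule nn_integral_cmult) measurable
  finally show ?thesis .
qed

lemma partial_energy_ball_finite:
  fixes m :: "'a::euclidean_space measure"
  assumes "finite_borel_measure m" "p \<ge> 0" "a > 0"
  shows "partial_energy p a m (cball 0 1) < \<infinity>"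
  using partial_energy_mono_bounded[OF assms(1,2), of "cball 0 1" a]
    nn_integral_norm_powr_ball[OF assms(3), where 'a = 'a]
  by (auto simp: ennreal_mult_less_top elim!: order.strict_trans1)

lemma partial_energy_outside_finite:
  fixes m :: "'a::euclidean_space measure"
  assumes m: "finite_borel_measure m" and p: "p \<ge> 0"
    and "a < 0 \<or> (\<exists>b\<ge>a. partial_energy p b m UNIV < \<infinity>)"
  shows "partial_energy p a m (- ball 0 1) < \<infinity>"
  using assms(3)
proof
  assume "a < 0"
  then show ?thesis
    using partial_energy_mono_bounded[OF m p, of "- ball 0 1" a]
      nn_integral_norm_powr_outside[of "- a", where 'a = 'a]
    by (auto simp: ennreal_mult_less_top elim!: order.strict_trans1)
next
  assume "\<exists>b\<ge>a. partial_energy p b m UNIV < \<infinity>"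
  then obtain b where b: "b \<ge> a" "partial_energy p b m UNIV < \<infinity>" by blast
  have "partial_energy p a m (- ball 0 1) \<le> partial_energy p b m UNIV"
    unfolding partial_energy_def using b(1)
    by (intro nn_integral_mono)
       (auto intro!: ennreal_leI mult_left_mono powr_mono split: split_indicator)
  then show ?thesis using b(2) by (rule order.strict_trans1)
qed

lemma norm_Pair_bounds:
  fixes x :: "'a::euclidean_space" and y :: "'b::euclidean_space"
  shows "norm x \<le> norm (x, y)" "norm y \<le> norm (x, y)" "norm (x, y) \<le> norm x + norm y"
  using norm_fst_le[of x y] norm_snd_le[of y x] norm_Pair_le[of x y] by auto

lemma powr_comparable:
  fixes a b q :: real
  assumes "0 < a" "0 < b" "a \<le> 2 * b" "b \<le> 2 * a"
  shows "a powr q \<le> 2 powr \<bar>q\<bar> * b powr q"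
proof (cases "q \<ge> 0")
  case True
  have "a powr q \<le> (2 * b) powr q" using assms True by (intro powr_mono2) auto
  then show ?thesis using assms True by (simp add: powr_mult)
next
  case False
  have "(2 * a) powr q \<le> b powr q" using assms False by (intro powr_mono2') auto
  then have "2 powr \<bar>q\<bar> * (2 powr q * a powr q) \<le> 2 powr \<bar>q\<bar> * b powr q"
    using assms by (intro mult_left_mono) (auto simp: powr_mult)
  moreover have "2 powr \<bar>q\<bar> * 2 powr q = (1::real)" using False by (simp flip: powr_add)
  ultimately show ?thesis by (simp flip: mult.assoc)
qed

section \<open>Upper bounds for products\<close>

lemma partial_energy_split:
  fixes m :: "'a::euclidean_space measure"
  assumes m: "finite_borel_measure m"
  shows "partial_energy p a m UNIV \<le> partial_energy p a m (cball 0 1) + partial_energy p a m (- ball 0 1)"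
proof -
  have [measurable]: "fourier_transform m \<in> borel_measurable borel"
    by (rule measurable_fourier_transform[OF m])
  let ?f = "\<lambda>z. ennreal (cmod (fourier_transform m z) powr p * norm z powr (a - real DIM('a)))"
  have "?f z \<le> ?f z * indicator (cball 0 1) z + ?f z * indicator (- ball 0 1) z" for z
    by (cases "norm z \<le> 1") (simp_all add: indicator_def)
  then have "partial_energy p a m UNIV
      \<le> (\<integral>\<^sup>+z. ?f z * indicator (cball 0 1) z + ?f z * indicator (- ball 0 1) z \<partial>lborel)"
    unfolding partial_energy_def by (intro nn_integral_mono) simp
  also have "\<dots> = partial_energy p a m (cball 0 1) + partial_energy p a m (- ball 0 1)"
    unfolding partial_energy_def by (rule nn_integral_add) measurable
  finally show ?thesis .
qed

text \<open>
  The spectral support of the weight lies in the unit ball, so the transform of the projection at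
  \<open>y\<close> only sees frequencies \<open>(\<xi>, y)\<close> with \<open>norm \<xi> \<le> 1\<close>; for \<open>norm y \<ge> 1\<close> these have norm
  comparable with \<open>norm y\<close>.  Near \<open>y = 0\<close> the energy of the projection converges
  because the exponent stays above minus the dimension, which is where
  \<open>s > DIM('a) * \<theta>\<close> enters.  For \<open>\<theta> = 0\<close> the mean inequality with exponent 2 works
  at each \<open>y\<close>.
\<close>

lemma projection_energy_finite:
  fixes X :: "'a::euclidean_space set" and Y :: "'b::euclidean_space set"
  assumes X: "compact X" and Y: "compact Y"
    and m: "nonzero_finite_borel_measure m" and spt: "spt m \<subseteq> X \<times> Y"
    and \<theta>: "0 \<le> \<theta>" "\<theta> \<le> 1" and s: "\<theta> = 0 \<or> s > real DIM('a) * \<theta>"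
    and s0: "0 \<le> s" and energy: "energy s \<theta> m < \<infinity>"
  obtains \<nu> where "nonzero_finite_borel_measure \<nu>" "spt \<nu> \<subseteq> Y"
    "energy (s - real DIM('a) * \<theta>) \<theta> \<nu> < \<infinity>"
proof -
  obtain \<nu> and \<kappa> :: "'a measure" and C where \<nu>: "nonzero_finite_borel_measure \<nu>" "spt \<nu> \<subseteq> Y"
    and \<kappa>: "finite_borel_measure \<kappa>"
    and C: "\<And>h::'a \<Rightarrow> ennreal. h \<in> borel_measurable borel \<Longrightarrow>
       (\<integral>\<^sup>+\<xi>. h \<xi> \<partial>\<kappa>) \<le> ennreal C * (\<integral>\<^sup>+\<xi>\<in>cball 0 1. h \<xi> \<partial>lborel)"
    and avg: "\<And>p y. 1 \<le> p \<Longrightarrow> ennreal (cmod (fourier_transform \<nu> y) powr p)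
       \<le> ennreal (measure \<kappa> UNIV powr (p - 1))
        * (\<integral>\<^sup>+\<xi>. ennreal (cmod (fourier_transform m (\<xi>, y)) powr p) \<partial>\<kappa>)"
    by (rule exists_projection[OF X Y m spt]) (rule that; assumption)
  have m': "finite_borel_measure m" and \<nu>': "finite_borel_measure \<nu>"
    using m \<nu> by (simp_all add: nonzero_finite_borel_measure_iff)
  have "fourier_transform m \<in> borel_measurable (borel \<Otimes>\<^sub>M borel)"
    using measurable_fourier_transform[OF m'] by (simp add: borel_prod)
  note [measurable] = this measurable_fourier_transform[OF \<nu>']
  have [measurable_cong]: "sets \<kappa> = sets borel" using \<kappa> by (simp add: finite_borel_measure_def)
  interpret k: finite_measure \<kappa> using \<kappa> by (simp add: finite_borel_measure_def)
  have "energy (s - real DIM('a) * \<theta>) \<theta> \<nu> < \<infinity>"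
  proof (cases "\<theta> = 0")
    case True
    then obtain B where B: "\<And>z. (cmod (fourier_transform m z))\<^sup>2 * norm z powr s \<le> B"
      using energy unfolding True energy_0_finite_iff by blast
    define K where "K = measure \<kappa> UNIV powr (2 - 1)"
    have "(cmod (fourier_transform \<nu> y))\<^sup>2 * norm y powr s \<le> K * (B * measure \<kappa> UNIV)" for y
    proof -
      have B': "norm y powr s * (cmod (fourier_transform m (\<xi>, y)))\<^sup>2 \<le> B" for \<xi>
      proof -
        have "norm y powr s * (cmod (fourier_transform m (\<xi>, y)))\<^sup>2
            \<le> norm (\<xi>, y) powr s * (cmod (fourier_transform m (\<xi>, y)))\<^sup>2"
          using s0 norm_Pair_bounds(2)[of y \<xi>] by (intro mult_right_mono powr_mono2) auto
        then show ?thesis using B[of "(\<xi>, y)"] by (simp add: mult.commute)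
      qed
      have B0: "0 \<le> B" by (rule order_trans[OF _ B']) simp
      have "ennreal ((cmod (fourier_transform \<nu> y))\<^sup>2 * norm y powr s)
          \<le> ennreal K * (\<integral>\<^sup>+\<xi>. ennreal ((cmod (fourier_transform m (\<xi>, y)))\<^sup>2) \<partial>\<kappa>) * ennreal (norm y powr s)"
        using avg[of 2 y] unfolding K_def by (simp add: ennreal_mult mult_right_mono powr_numeral)
      also have "\<dots> = ennreal K *
          (\<integral>\<^sup>+\<xi>. ennreal (norm y powr s) * ennreal ((cmod (fourier_transform m (\<xi>, y)))\<^sup>2) \<partial>\<kappa>)"
        by (subst nn_integral_cmult) (auto simp: mult_ac)
      also have "\<dots> \<le> ennreal K * (\<integral>\<^sup>+\<xi>. ennreal B \<partial>\<kappa>)"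
        using B' by (intro mult_left_mono nn_integral_mono) (auto simp flip: ennreal_mult' intro!: ennreal_leI)
      also have "\<dots> = ennreal (K * (B * measure \<kappa> UNIV))"
        using B0 by (simp add: k.emeasure_eq_measure space_finite_borel_measure[OF \<kappa>] K_def ennreal_mult)
      finally show ?thesis using B0 by (subst (asm) ennreal_le_iff) (auto simp: K_def)
    qed
    then have "energy s 0 \<nu> < \<infinity>" unfolding energy_0_finite_iff by blast
    then show ?thesis using True by simp
  next
    case False
    then have \<theta>0: "\<theta> > 0" and s': "s > real DIM('a) * \<theta>" using \<theta> s by auto
    define p u where "p = 2 / \<theta>" and "u = s / \<theta>"
    define q where "q = u - real DIM('a \<times> 'b)"
    have p: "p \<ge> 1" using \<theta> \<theta>0 by (simp add: p_def field_simps)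
    have u: "u > real DIM('a)" using s' \<theta>0 by (simp add: u_def field_simps)
    have q: "q = (u - real DIM('a)) - real DIM('b)" by (simp add: q_def)
    define K where "K = measure \<kappa> UNIV powr (p - 1)"
    let ?g = "\<lambda>\<xi> y. ennreal (cmod (fourier_transform m (\<xi>, y)) powr p)"
    let ?G = "\<lambda>z. ennreal (cmod (fourier_transform m z) powr p * norm z powr q)"
    have pointwise: "ennreal (cmod (fourier_transform \<nu> y) powr p * norm y powr q)
        \<le> ennreal K * ennreal C * ennreal (2 powr \<bar>q\<bar>) * (\<integral>\<^sup>+\<xi>. ?G (\<xi>, y) \<partial>lborel)"
      if y: "norm y \<ge> 1" for y
    proof -
      have cmp: "norm y powr q \<le> 2 powr \<bar>q\<bar> * norm (\<xi>, y) powr q" if "norm \<xi> \<le> 1" for \<xi> :: 'a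
        using y that norm_Pair_bounds(2)[of y \<xi>] norm_Pair_bounds(3)[of \<xi> y]
        by (intro powr_comparable) linarith+
      have "ennreal (cmod (fourier_transform \<nu> y) powr p * norm y powr q)
          \<le> ennreal K * (\<integral>\<^sup>+\<xi>. ?g \<xi> y \<partial>\<kappa>) * ennreal (norm y powr q)"
        using avg[OF p, of y] unfolding K_def by (simp add: ennreal_mult mult_right_mono)
      also have "\<dots> \<le> ennreal K * (ennreal C * (\<integral>\<^sup>+\<xi>\<in>cball 0 1. ?g \<xi> y \<partial>lborel))
          * ennreal (norm y powr q)"
        by (intro mult_right_mono mult_left_mono C) auto
      also have "\<dots> = ennreal K * ennreal C
          * (\<integral>\<^sup>+\<xi>. ennreal (norm y powr q) * (?g \<xi> y * indicator (cball 0 1) \<xi>) \<partial>lborel)"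
        by (subst nn_integral_cmult) (auto simp: mult_ac)
      also have "\<dots> \<le> ennreal K * ennreal C * (\<integral>\<^sup>+\<xi>. ennreal (2 powr \<bar>q\<bar>) * ?G (\<xi>, y) \<partial>lborel)"
      proof (intro mult_left_mono nn_integral_mono)
        fix \<xi> :: 'a
        show "ennreal (norm y powr q) * (?g \<xi> y * indicator (cball 0 1) \<xi>)
            \<le> ennreal (2 powr \<bar>q\<bar>) * ?G (\<xi>, y)"
          using mult_right_mono[OF cmp[of \<xi>], of "cmod (fourier_transform m (\<xi>, y)) powr p"]
          by (auto split: split_indicator simp: mult_ac intro!: ennreal_leI simp flip: ennreal_mult')
      qed auto
      also have "\<dots> = ennreal K * ennreal C * ennreal (2 powr \<bar>q\<bar>) * (\<integral>\<^sup>+\<xi>. ?G (\<xi>, y) \<partial>lborel)"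
        by (subst nn_integral_cmult) (auto simp: mult_ac)
      finally show ?thesis .
    qed
    have "partial_energy p (u - real DIM('a)) \<nu> (- ball 0 1)
        \<le> (\<integral>\<^sup>+y. ennreal K * ennreal C * ennreal (2 powr \<bar>q\<bar>) * (\<integral>\<^sup>+\<xi>. ?G (\<xi>, y) \<partial>lborel) \<partial>lborel)"
      unfolding partial_energy_def q[symmetric]
      by (intro nn_integral_mono) (auto split: split_indicator intro!: pointwise)
    also have "\<dots> = ennreal K * ennreal C * ennreal (2 powr \<bar>q\<bar>)
        * (\<integral>\<^sup>+y. (\<integral>\<^sup>+\<xi>. ?G (\<xi>, y) \<partial>lborel) \<partial>lborel)"
      by (intro nn_integral_cmult) measurable
    also have "(\<integral>\<^sup>+y. (\<integral>\<^sup>+\<xi>. ?G (\<xi>, y) \<partial>lborel) \<partial>lborel) = (\<integral>\<^sup>+z. ?G z \<partial>(lborel \<Otimes>\<^sub>M lborel))"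
    proof (rule lborel_pair.nn_integral_snd)
      have [measurable]: "fourier_transform m \<in> borel_measurable borel"
        by (rule measurable_fourier_transform[OF m'])
      show "?G \<in> borel_measurable (lborel \<Otimes>\<^sub>M lborel)"
        unfolding lborel_prod by measurable
    qed
    also have "\<dots> = partial_energy p u m UNIV"
      unfolding partial_energy_def q_def lborel_prod by simp
    also have "ennreal K * ennreal C * ennreal (2 powr \<bar>q\<bar>) * partial_energy p u m UNIV < \<infinity>"
      using energy_finite_iff_partial[OF \<theta>0, THEN iffD1, OF energy]
      by (simp add: ennreal_mult_less_top p_def u_def)
    finally have "partial_energy p (u - real DIM('a)) \<nu> (- ball 0 1) < \<infinity>" .
    moreover have "partial_energy p (u - real DIM('a)) \<nu> (cball 0 1) < \<infinity>"
      using u p by (intro partial_energy_ball_finite \<nu>') auto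
    ultimately have "partial_energy p (u - real DIM('a)) \<nu> UNIV < \<infinity>"
      using partial_energy_split[OF \<nu>', of p "u - real DIM('a)"]
      by (simp add: order.strict_trans1)
    moreover have "(s - real DIM('a) * \<theta>) / \<theta> = u - real DIM('a)"
      using \<theta>0 by (simp add: u_def field_simps)
    ultimately show ?thesis
      unfolding energy_finite_iff_partial[OF \<theta>0] p_def by simp
  qed
  with \<nu> show thesis by (rule that)
qed

lemma lborel_swap:
  "distr (lborel :: ('a::euclidean_space \<times> 'b::euclidean_space) measure) borel prod.swap = lborel"
proof -
  have "distr (lborel \<Otimes>\<^sub>M lborel) (lborel \<Otimes>\<^sub>M lborel) (\<lambda>(x :: 'a, y :: 'b). (y, x))
      = lborel \<Otimes>\<^sub>M lborel"
    by (rule lborel_pair.distr_pair_swap[symmetric])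
  moreover have "(\<lambda>(x :: 'a, y :: 'b). (y, x)) = prod.swap" by auto
  ultimately have "distr lborel lborel (prod.swap :: 'a \<times> 'b \<Rightarrow> _) = lborel"
    by (simp only: lborel_prod)
  moreover have "distr lborel lborel (prod.swap :: 'a \<times> 'b \<Rightarrow> _) = distr lborel borel prod.swap"
    by (rule distr_cong) auto
  ultimately show ?thesis by simp
qed

lemma norm_swap: "norm (prod.swap z) = norm z"
  by (cases z) (simp add: norm_Pair add.commute)

lemma exists_swapped_measure:
  fixes X :: "'a::euclidean_space set" and Y :: "'b::euclidean_space set"
  assumes XY: "closed X" "closed Y"
    and m: "nonzero_finite_borel_measure m" and spt: "spt m \<subseteq> X \<times> Y"
  obtains n where "nonzero_finite_borel_measure n" "spt n \<subseteq> Y \<times> X"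
    "\<And>s \<theta>. energy s \<theta> n = energy s \<theta> m"
proof -
  have m': "finite_borel_measure m" and mnz: "emeasure m UNIV \<noteq> 0"
    using m by (simp_all add: nonzero_finite_borel_measure_iff)
  have sm [measurable_cong]: "sets m = sets borel" using m' by (simp add: finite_borel_measure_def)
  define n where "n = distr m borel prod.swap"
  have swap: "prod.swap \<in> borel_measurable borel"
    by (intro borel_measurable_continuous_onI continuous_on_swap)
  then have swap_m: "prod.swap \<in> borel_measurable m" by (simp add: measurable_cong_sets[OF sm refl])
  have n': "finite_borel_measure n"
    unfolding n_def by (intro finite_borel_measure_distr m' swap)
  have em: "emeasure n A = emeasure m (prod.swap -` A)" if "A \<in> sets borel" for A
    unfolding n_def using that swap_m space_finite_borel_measure[OF m']
    by (subst emeasure_distr) auto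
  have 1: "nonzero_finite_borel_measure n"
    using n' mnz em[of UNIV] by (simp add: nonzero_finite_borel_measure_iff)
  have cl: "closed (X \<times> Y)" "closed (Y \<times> X)" using XY by (auto intro: closed_Times)
  have "emeasure n (- (Y \<times> X)) = emeasure m (prod.swap -` (- (Y \<times> X)))"
    using cl(2) by (intro em) auto
  also have "prod.swap -` (- (Y \<times> X)) = - (X \<times> Y)" by auto
  also have "emeasure m (- (X \<times> Y)) = 0" by (rule spt_subset_iff[OF sm cl(1), THEN iffD1, OF spt])
  finally have null: "emeasure n (- (Y \<times> X)) = 0" .
  have "sets n = sets borel" by (simp add: n_def)
  then have 2: "spt n \<subseteq> Y \<times> X" by (rule spt_subset_iff[OF _ cl(2), THEN iffD2, OF _ null])
  have ft: "fourier_transform n z = fourier_transform m (prod.swap z)" for z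
  proof -
    have "fourier_transform n z = (\<integral>p. character z (prod.swap p) \<partial>m)"
      unfolding fourier_transform_character n_def
      by (rule integral_distr[OF swap_m measurable_character_right])
    moreover have "(\<lambda>p. character z (prod.swap p)) = character (prod.swap z)"
      by (cases z) (auto simp: character_Pair)
    ultimately show ?thesis by (simp only: fourier_transform_character)
  qed
  have 3: "energy s \<theta> n = energy s \<theta> m" for s \<theta>
  proof (cases "\<theta> = 0")
    case True
    let ?f = "\<lambda>z. ennreal ((cmod (fourier_transform m z))\<^sup>2 * norm z powr s)"
    have "(SUP z. ?f (prod.swap z)) = (SUP z\<in>range prod.swap. ?f z)"
      by (simp only: image_image)
    then have "(SUP z. ?f (prod.swap z)) = (SUP z. ?f z)" unfolding surj_swap .
    then show ?thesis using True unfolding energy_def ft norm_swap by simp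
  next
    case False
    have [measurable]: "fourier_transform m \<in> borel_measurable borel"
      by (rule measurable_fourier_transform[OF m'])
    let ?f = "\<lambda>z. ennreal (cmod (fourier_transform m z) powr (2 / \<theta>)
                 * norm z powr (s / \<theta> - real DIM('a \<times> 'b)))"
    have "(\<integral>\<^sup>+z. ?f z \<partial>lborel) = (\<integral>\<^sup>+z. ?f z \<partial>distr lborel borel prod.swap)"
      unfolding lborel_swap ..
    also have "\<dots> = (\<integral>\<^sup>+z. ?f (prod.swap z) \<partial>lborel)"
      by (rule nn_integral_distr) (simp add: swap, measurable)
    finally have "(\<integral>\<^sup>+z. ?f (prod.swap z) \<partial>lborel) = (\<integral>\<^sup>+z. ?f z \<partial>lborel)" ..
    moreover have "DIM('b \<times> 'a) = DIM('a \<times> 'b)" by (simp add: add.commute)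
    ultimately show ?thesis using False unfolding energy_def ft norm_swap by (simp only: if_False)
  qed
  show thesis by (rule that[OF 1 2 3])
qed

section \<open>Measures on Lebesgue null sets\<close>

text \<open>
  The transform of the autocorrelation of a ball of radius \<open>1 / (12 * r)\<close> is bounded below on
  \<open>cball 0 (2 * r)\<close>; integrating it against the autocorrelation of \<open>m\<close> and
  exchanging the two transforms leaves the square integral of the transform of \<open>m\<close>.
\<close>

lemma autocorrelation_cball_le:
  fixes m :: "'a::euclidean_space measure"
  assumes m: "finite_borel_measure m" and r: "r > 0"
  shows "ennreal (measure lborel (cball (0::'a) (1 / (12 * r))) / 4)
      * emeasure (autocorrelation m) (cball 0 (2 * r))
    \<le> (\<integral>\<^sup>+z. ennreal ((cmod (fourier_transform m z))\<^sup>2) \<partial>lborel)"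
    (is "_ \<le> ?J")
proof -
  define \<delta> where "\<delta> = 1 / (12 * r)"
  define V where "V = measure lborel (cball (0::'a) \<delta>)"
  have \<delta>: "\<delta> > 0" using r by (simp add: \<delta>_def)
  have V: "V > 0" unfolding V_def using \<delta> by (rule content_cball_pos)
  let ?B = "ball_measure \<delta> :: 'a measure"
  define \<kappa> D where "\<kappa> = autocorrelation ?B" and "D = autocorrelation m"
  have B: "finite_borel_measure ?B" by (rule finite_borel_measure_ball_measure)
  have \<kappa>: "finite_borel_measure \<kappa>" unfolding \<kappa>_def by (rule finite_borel_measure_autocorrelation[OF B])
  have D: "finite_borel_measure D" unfolding D_def by (rule finite_borel_measure_autocorrelation[OF m])
  interpret k: finite_measure \<kappa> using \<kappa> by (simp add: finite_borel_measure_def)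
  interpret D: finite_measure D using D by (simp add: finite_borel_measure_def)
  have [measurable_cong]: "sets \<kappa> = sets borel" "sets D = sets borel"
    using \<kappa> D by (simp_all add: finite_borel_measure_def)
  have [measurable]: "fourier_transform m \<in> borel_measurable borel"
      "fourier_transform ?B \<in> borel_measurable borel"
    using m B by (simp_all add: measurable_fourier_transform)
  let ?h = "\<lambda>w. (cmod (fourier_transform ?B w))\<^sup>2"
  let ?g = "\<lambda>z. (cmod (fourier_transform m z))\<^sup>2"
  have int_h: "integrable D ?h"
    by (rule D.integrable_const_bound[where B="(measure ?B UNIV)\<^sup>2"])
       (simp_all add: norm_fourier_transform_le[OF B] power_mono)
  have int_g: "integrable \<kappa> ?g"
    by (rule k.integrable_const_bound[where B="(measure m UNIV)\<^sup>2"])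
       (simp_all add: norm_fourier_transform_le[OF m] power_mono)
  have "complex_of_real (\<integral>w. ?h w \<partial>D) = (\<integral>w. fourier_transform \<kappa> w \<partial>D)"
    unfolding \<kappa>_def fourier_transform_autocorrelation[OF B]
    by (rule integral_complex_of_real[symmetric])
  also have "\<dots> = (\<integral>z. fourier_transform D z \<partial>\<kappa>)"
    by (rule fourier_multiplication_formula[OF D \<kappa>])
  also have "\<dots> = complex_of_real (\<integral>z. ?g z \<partial>\<kappa>)"
    unfolding D_def fourier_transform_autocorrelation[OF m]
    by (rule integral_complex_of_real)
  finally have eq: "(\<integral>w. ?h w \<partial>D) = (\<integral>z. ?g z \<partial>\<kappa>)" by (simp only: of_real_eq_iff)
  have lower: "(V / 2)\<^sup>2 \<le> ?h w" if "norm w \<le> 2 * r" for w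
  proof -
    have "6 * \<delta> * norm w \<le> 6 * \<delta> * (2 * r)" using that \<delta> by (intro mult_left_mono) auto
    also have "\<dots> = 1" using r by (simp add: \<delta>_def)
    finally have "V / 2 \<le> cmod (fourier_transform ?B w)"
      unfolding V_def by (rule fourier_transform_ball_measure_ge)
    then show ?thesis using V by (intro power_mono) auto
  qed
  have "ennreal V * (ennreal (V / 4) * emeasure D (cball 0 (2 * r)))
      = ennreal ((V / 2)\<^sup>2) * emeasure D (cball 0 (2 * r))"
    using V by (simp add: power2_eq_square flip: mult.assoc ennreal_mult')
  also have "\<dots> = (\<integral>\<^sup>+w. ennreal ((V / 2)\<^sup>2) * indicator (cball 0 (2 * r)) w \<partial>D)"
    by (rule nn_integral_cmult_indicator[symmetric]) measurable
  also have "\<dots> \<le> (\<integral>\<^sup>+w. ennreal (?h w) \<partial>D)"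
    using lower by (intro nn_integral_mono) (auto split: split_indicator intro!: ennreal_leI)
  also have "\<dots> = ennreal (\<integral>w. ?h w \<partial>D)"
    by (rule nn_integral_eq_integral[OF int_h]) simp
  also have "\<dots> = ennreal (\<integral>z. ?g z \<partial>\<kappa>)"
    unfolding eq ..
  also have "\<dots> = (\<integral>\<^sup>+z. ennreal (?g z) \<partial>\<kappa>)"
    by (rule nn_integral_eq_integral[OF int_g, symmetric]) simp
  also have "\<dots> \<le> ennreal V * (\<integral>\<^sup>+z\<in>cball 0 (2 * \<delta>). ennreal (?g z) \<partial>lborel)"
    unfolding \<kappa>_def V_def by (rule nn_integral_autocorrelation_ball_le) measurable
  also have "\<dots> \<le> ennreal V * ?J"
    by (intro mult_left_mono nn_integral_mono) (auto split: split_indicator)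
  finally show ?thesis
    using V unfolding V_def[symmetric] D_def[symmetric] \<delta>_def[symmetric]
    by (subst (asm) ennreal_mult_le_mult_iff) auto
qed

text \<open>
  Spread the mass over balls of radius \<open>r\<close>: the function \<open>\<lambda>x. m (cball x r)\<close> lives on the
  \<open>r\<close>-neighbourhood of \<open>X\<close>, and its square integral counts pairs of points at distance at most
  \<open>2 * r\<close>.  Cauchy--Schwarz compares the two.
\<close>

lemma mass_square_le:
  fixes m :: "'a::euclidean_space measure"
  assumes m: "finite_borel_measure m" and AE: "AE y in m. y \<in> X" and r: "r > 0"
  shows "ennreal (measure lborel (cball (0::'a) r)) * (emeasure m UNIV)\<^sup>2
    \<le> emeasure (autocorrelation m) (cball 0 (2 * r)) * emeasure lborel {x. infdist x X \<le> r}"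
proof -
  define V where "V = measure lborel (cball (0::'a) r)"
  define N where "N = {x. infdist x X \<le> r}"
  have V: "V > 0" unfolding V_def using r by (rule content_cball_pos)
  interpret m: finite_measure m using m by (simp add: finite_borel_measure_def)
  have [measurable_cong]: "sets m = sets borel" using m by (simp add: finite_borel_measure_def)
  interpret P: pair_sigma_finite lborel m ..
  have "closed N"
    unfolding N_def by (intro closed_Collect_le continuous_intros)
  then have N [measurable]: "N \<in> sets borel" by (rule borel_closed)
  define i :: "'a \<Rightarrow> 'a \<Rightarrow> ennreal" where "i x y = indicator {..r} (dist x y)" for x y
  have i_meas [measurable]: "(\<lambda>p. i (f p) (g p)) \<in> borel_measurable M"
    if [measurable]: "f \<in> borel_measurable M" "g \<in> borel_measurable M" for f g and M :: "'c measure"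
    unfolding i_def by measurable
  have i_ball: "i x y = indicator (cball y r) x" for x y
    by (auto simp: i_def dist_commute split: split_indicator)
  have vol: "(\<integral>\<^sup>+x. i x y \<partial>lborel) = ennreal V" for y
  proof -
    have "(\<integral>\<^sup>+x. i x y \<partial>lborel) = emeasure lborel (cball y r)"
      unfolding i_ball by simp
    also have "\<dots> = ennreal V"
      using r by (simp add: emeasure_cball V_def content_cball)
    finally show ?thesis .
  qed
  let ?f = "\<lambda>x. \<integral>\<^sup>+y. i x y \<partial>m"
  have f_meas [measurable]: "?f \<in> borel_measurable lborel" by measurable
  have "ennreal V * emeasure m UNIV = (\<integral>\<^sup>+y. (\<integral>\<^sup>+x. i x y * indicator N x \<partial>lborel) \<partial>m)"
  proof -
    have "(\<integral>\<^sup>+x. i x y * indicator N x \<partial>lborel) = ennreal V" if "y \<in> X" for y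
    proof -
      have "i x y * indicator N x = i x y" for x
        using infdist_le[OF that, of x] by (auto simp: i_def N_def split: split_indicator)
      then show ?thesis using vol by simp
    qed
    with AE have "(\<integral>\<^sup>+y. (\<integral>\<^sup>+x. i x y * indicator N x \<partial>lborel) \<partial>m) = (\<integral>\<^sup>+y. ennreal V \<partial>m)"
      by (intro nn_integral_cong_AE) auto
    then show ?thesis by (simp add: space_finite_borel_measure[OF m])
  qed
  also have "\<dots> = (\<integral>\<^sup>+x. (\<integral>\<^sup>+y. i x y * indicator N x \<partial>m) \<partial>lborel)"
    by (rule P.Fubini') measurable
  also have "\<dots> = (\<integral>\<^sup>+x. ?f x * indicator N x \<partial>lborel)"
    by (intro nn_integral_cong nn_integral_multc) measurable
  finally have mass: "ennreal V * emeasure m UNIV = (\<integral>\<^sup>+x. ?f x * indicator N x \<partial>lborel)" .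
  have "(\<integral>\<^sup>+x. (?f x)\<^sup>2 \<partial>lborel) = (\<integral>\<^sup>+x. (\<integral>\<^sup>+y. (\<integral>\<^sup>+y'. i x y * i x y' \<partial>m) \<partial>m) \<partial>lborel)"
    by (simp add: nn_integral_cmult nn_integral_multc power2_eq_square)
  also have "\<dots> = (\<integral>\<^sup>+y. (\<integral>\<^sup>+x. (\<integral>\<^sup>+y'. i x y * i x y' \<partial>m) \<partial>lborel) \<partial>m)"
    by (rule P.Fubini'[symmetric]) measurable
  also have "\<dots> = (\<integral>\<^sup>+y. (\<integral>\<^sup>+y'. (\<integral>\<^sup>+x. i x y * i x y' \<partial>lborel) \<partial>m) \<partial>m)"
    by (intro nn_integral_cong P.Fubini'[symmetric]) measurable
  also have "\<dots> \<le> (\<integral>\<^sup>+y. (\<integral>\<^sup>+y'. ennreal V * indicator (cball 0 (2 * r)) (y - y') \<partial>m) \<partial>m)"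
  proof (intro nn_integral_mono)
    fix y y' :: 'a
    have "i x y * i x y' \<le> i x y * indicator (cball 0 (2 * r)) (y - y')" for x
      using dist_triangle2[of y y' x]
      by (auto simp: i_def dist_norm norm_minus_commute dist_commute split: split_indicator)
    then have "(\<integral>\<^sup>+x. i x y * i x y' \<partial>lborel)
        \<le> (\<integral>\<^sup>+x. i x y * indicator (cball 0 (2 * r)) (y - y') \<partial>lborel)"
      by (rule nn_integral_mono)
    also have "\<dots> = ennreal V * indicator (cball 0 (2 * r)) (y - y')"
      by (subst nn_integral_multc) (auto simp: vol)
    finally show "(\<integral>\<^sup>+x. i x y * i x y' \<partial>lborel)
        \<le> ennreal V * indicator (cball 0 (2 * r)) (y - y')" .
  qed
  also have "\<dots> = (\<integral>\<^sup>+z. ennreal V * indicator (cball 0 (2 * r)) z \<partial>autocorrelation m)"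
    by (rule nn_integral_autocorrelation[OF m, symmetric]) measurable
  also have "\<dots> = ennreal V * emeasure (autocorrelation m) (cball 0 (2 * r))"
    by (rule nn_integral_cmult_indicator) (simp add: autocorrelation_def)
  finally have square: "(\<integral>\<^sup>+x. (?f x)\<^sup>2 \<partial>lborel)
    \<le> ennreal V * emeasure (autocorrelation m) (cball 0 (2 * r))" .
  have "ennreal V * (ennreal V * (emeasure m UNIV)\<^sup>2) = (\<integral>\<^sup>+x. ?f x * indicator N x \<partial>lborel)\<^sup>2"
    unfolding mass[symmetric] by (simp add: power2_eq_square mult_ac)
  also have "\<dots> \<le> (\<integral>\<^sup>+x. (?f x)\<^sup>2 \<partial>lborel) * (\<integral>\<^sup>+x. (indicator N x)\<^sup>2 \<partial>lborel)"
    by (rule Cauchy_Schwarz_nn_integral) measurable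
  also have "(\<integral>\<^sup>+x. (indicator N x)\<^sup>2 \<partial>lborel) = (\<integral>\<^sup>+x. indicator N x \<partial>lborel)"
    by (intro nn_integral_cong) (auto split: split_indicator)
  also have "\<dots> = emeasure lborel N" by simp
  also have "(\<integral>\<^sup>+x. (?f x)\<^sup>2 \<partial>lborel) * emeasure lborel N
      \<le> ennreal V * emeasure (autocorrelation m) (cball 0 (2 * r)) * emeasure lborel N"
    by (intro mult_right_mono square) simp
  finally show ?thesis
    using V unfolding V_def[symmetric] N_def[symmetric] mult.assoc
    by (subst (asm) ennreal_mult_le_mult_iff) auto
qed

lemma tendsto_emeasure_infdist:
  fixes X :: "'a::euclidean_space set"
  assumes X: "compact X" "X \<noteq> {}"
  shows "(\<lambda>n. emeasure lborel {x. infdist x X \<le> 1 / real (Suc n)}) \<longlonglongrightarrow> emeasure lborel X"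
proof -
  let ?N = "\<lambda>n. {x. infdist x X \<le> 1 / real (Suc n)}"
  have closed: "closed (?N n)" for n by (intro closed_Collect_le continuous_intros)
  have dec: "decseq ?N"
  proof (rule decseq_SucI)
    fix n
    have "1 / real (Suc (Suc n)) \<le> 1 / real (Suc n)" by (simp add: frac_le)
    then show "?N (Suc n) \<subseteq> ?N n" by auto
  qed
  have "(\<Inter>n. ?N n) = X"
  proof
    show "X \<subseteq> (\<Inter>n. ?N n)" by (auto simp: infdist_zero)
    show "(\<Inter>n. ?N n) \<subseteq> X"
    proof
      fix x assume x: "x \<in> (\<Inter>n. ?N n)"
      have "infdist x X \<le> 0"
      proof (rule ccontr)
        assume "\<not> infdist x X \<le> 0"
        then obtain n where "inverse (real (Suc n)) < infdist x X"
          using reals_Archimedean[of "infdist x X"] by auto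
        moreover have "infdist x X \<le> 1 / real (Suc n)" using x by blast
        ultimately show False by (simp add: inverse_eq_divide)
      qed
      then have "infdist x X = 0" using infdist_nonneg[of x X] by linarith
      then show "x \<in> X"
        using in_closed_iff_infdist_zero[OF compact_imp_closed[OF X(1)] X(2)] by blast
    qed
  qed
  moreover have fin: "emeasure lborel (?N n) \<noteq> \<infinity>" for n
  proof -
    have "compact (?N n)" using X by (intro compact_infdist_le) auto
    then have "emeasure lborel (?N n) < \<infinity>" by (rule emeasure_compact_finite)
    then show ?thesis by simp
  qed
  ultimately show ?thesis
    using Lim_emeasure_decseq[of ?N lborel, OF _ dec fin] closed
    by (simp add: image_subset_iff borel_closed del: of_nat_Suc)
qed

text \<open>
  Combine the two estimates: the bound on the mass in the first has the volume of
  an \<open>r\<close>-ball in it, which the volume of the ball of radius \<open>1 / (12 * r)\<close> in the second compensates.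
  What remains is the volume of the \<open>r\<close>-neighbourhood of \<open>X\<close>, and \<open>r \<rightarrow> 0\<close>.
\<close>

proposition nn_integral_fourier_transform_null_set:
  fixes X :: "'a::euclidean_space set"
  assumes X: "compact X" "X \<noteq> {}" "X \<in> null_sets lborel"
    and m: "nonzero_finite_borel_measure m" and spt: "spt m \<subseteq> X"
  shows "(\<integral>\<^sup>+z. ennreal ((cmod (fourier_transform m z))\<^sup>2) \<partial>lborel) = \<infinity>"
proof (rule ccontr)
  let ?J = "\<integral>\<^sup>+z. ennreal ((cmod (fourier_transform m z))\<^sup>2) \<partial>lborel"
  assume "?J \<noteq> \<infinity>"
  then have J: "?J < \<infinity>" by (simp add: top.not_eq_extremum)
  have m': "finite_borel_measure m" and mnz: "emeasure m UNIV \<noteq> 0"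
    using m by (simp_all add: nonzero_finite_borel_measure_iff)
  have sm: "sets m = sets borel" using m' by (simp add: finite_borel_measure_def)
  have cl: "closed X" by (rule compact_imp_closed[OF X(1)])
  have "emeasure m (- X) = 0" by (rule spt_subset_iff[OF sm cl, THEN iffD1, OF spt])
  then have AE: "AE y in m. y \<in> X"
    using cl by (intro AE_I[of _ _ "- X"]) (auto simp: sm)
  let ?N = "\<lambda>r. {x. infdist x X \<le> r}"
  \<comment> \<open>A quarter of the product of the volumes of balls of radius \<open>r\<close> and \<open>1 / (12 * r)\<close>.\<close>
  define c where "c = (unit_ball_vol (real DIM('a)))\<^sup>2 * (1 / 12) ^ DIM('a) / 4"
  have c: "c > 0"
    using unit_ball_vol_pos[of "real DIM('a)"] unfolding c_def
    by (intro divide_pos_pos mult_pos_pos zero_less_power) auto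
  have bound: "ennreal c * (emeasure m UNIV)\<^sup>2 \<le> ?J * emeasure lborel (?N r)" if r: "r > 0" for r
  proof -
    let ?V = "measure lborel (cball (0::'a) r)"
    let ?W = "measure lborel (cball (0::'a) (1 / (12 * r))) / 4"
    have "?W * ?V = c"
      using r by (simp add: content_cball c_def power2_eq_square flip: power_mult_distrib)
    then have "ennreal c * (emeasure m UNIV)\<^sup>2
        = ennreal ?W * (ennreal ?V * (emeasure m UNIV)\<^sup>2)"
      by (simp flip: mult.assoc ennreal_mult')
    also have "\<dots> \<le> ennreal ?W * (emeasure (autocorrelation m) (cball 0 (2 * r)) * emeasure lborel (?N r))"
      by (intro mult_left_mono mass_square_le m' AE r) simp
    also have "\<dots> \<le> ?J * emeasure lborel (?N r)"
      unfolding mult.assoc[symmetric]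
      by (intro mult_right_mono autocorrelation_cball_le m' r) simp
    finally show ?thesis .
  qed
  have "(\<lambda>n. ?J * emeasure lborel (?N (1 / real (Suc n)))) \<longlonglongrightarrow> ?J * emeasure lborel X"
    using J by (intro ennreal_tendsto_cmult tendsto_emeasure_infdist X(1,2)) simp
  then have "ennreal c * (emeasure m UNIV)\<^sup>2 \<le> ?J * emeasure lborel X"
    by (rule LIMSEQ_le_const) (use bound in auto)
  then have "ennreal c * (emeasure m UNIV)\<^sup>2 = 0" using X(3) by auto
  then show False using c mnz by simp
qed

section \<open>Lower bounds for products\<close>

lemma spt_pair_measure_subset:
  fixes \<mu> :: "'a::euclidean_space measure" and \<nu> :: "'b::euclidean_space measure"
  assumes \<mu>: "nonzero_finite_borel_measure \<mu>" "spt \<mu> \<subseteq> X" "closed X"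
    and \<nu>: "nonzero_finite_borel_measure \<nu>" "spt \<nu> \<subseteq> Y" "closed Y"
  shows "nonzero_finite_borel_measure (\<mu> \<Otimes>\<^sub>M \<nu>)" "spt (\<mu> \<Otimes>\<^sub>M \<nu>) \<subseteq> X \<times> Y"
proof -
  have fin: "finite_borel_measure \<mu>" "finite_borel_measure \<nu>"
    and nz: "emeasure \<mu> UNIV \<noteq> 0" "emeasure \<nu> UNIV \<noteq> 0"
    using \<mu>(1) \<nu>(1) by (simp_all add: nonzero_finite_borel_measure_iff)
  interpret n: finite_measure \<nu> using fin by (simp add: finite_borel_measure_def)
  have s: "sets \<mu> = sets borel" "sets \<nu> = sets borel"
    using fin by (simp_all add: finite_borel_measure_def)
  have P: "finite_borel_measure (\<mu> \<Otimes>\<^sub>M \<nu>)"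
    by (rule finite_borel_measure_pair[OF fin])
  then have sP: "sets (\<mu> \<Otimes>\<^sub>M \<nu>) = sets borel" by (simp add: finite_borel_measure_def)
  have em: "emeasure (\<mu> \<Otimes>\<^sub>M \<nu>) (A \<times> B) = emeasure \<mu> A * emeasure \<nu> B"
    if "A \<in> sets borel" "B \<in> sets borel" for A B
    using that by (intro n.emeasure_pair_measure_Times) (simp_all add: s)
  have "emeasure (\<mu> \<Otimes>\<^sub>M \<nu>) (UNIV \<times> UNIV) = emeasure \<mu> UNIV * emeasure \<nu> UNIV"
    by (rule em) auto
  with nz P show "nonzero_finite_borel_measure (\<mu> \<Otimes>\<^sub>M \<nu>)"
    unfolding nonzero_finite_borel_measure_iff by simp
  have null: "emeasure \<mu> (- X) = 0" "emeasure \<nu> (- Y) = 0"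
    by (rule spt_subset_iff[OF s(1) \<mu>(3), THEN iffD1, OF \<mu>(2)],
        rule spt_subset_iff[OF s(2) \<nu>(3), THEN iffD1, OF \<nu>(2)])
  have c: "- X \<in> sets borel" "- Y \<in> sets borel" using \<mu>(3) \<nu>(3) by auto
  have "(- X) \<times> UNIV \<in> null_sets (\<mu> \<Otimes>\<^sub>M \<nu>)" "UNIV \<times> (- Y) \<in> null_sets (\<mu> \<Otimes>\<^sub>M \<nu>)"
    using em[OF c(1), of UNIV] em[OF _ c(2), of UNIV] null c
    by (auto simp: null_sets_def s intro!: pair_measureI)
  then have "(- X) \<times> UNIV \<union> UNIV \<times> (- Y) \<in> null_sets (\<mu> \<Otimes>\<^sub>M \<nu>)"
    by (rule null_sets.Un)
  also have "(- X) \<times> UNIV \<union> UNIV \<times> (- Y) = - (X \<times> Y)" by auto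
  finally have "emeasure (\<mu> \<Otimes>\<^sub>M \<nu>) (- (X \<times> Y)) = 0" by auto
  then show "spt (\<mu> \<Otimes>\<^sub>M \<nu>) \<subseteq> X \<times> Y"
    by (rule spt_subset_iff[OF sP closed_Times[OF \<mu>(3) \<nu>(3)], THEN iffD2])
qed

lemma norm_Pair_powr_le:
  fixes x :: "'a::euclidean_space" and y :: "'b::euclidean_space"
  assumes "x \<noteq> 0" "y \<noteq> 0" "\<alpha> \<le> 0" "\<beta> \<le> 0"
  shows "norm (x, y) powr (\<alpha> + \<beta>) \<le> norm x powr \<alpha> * norm y powr \<beta>"
  unfolding powr_add
  using assms norm_Pair_bounds[of x y] norm_Pair_bounds(2)[of y x]
  by (intro mult_mono powr_mono2') auto

text \<open>
  The bound is asked for only off the two axes, since \<open>0 powr \<alpha> = 0\<close> makes it false there for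
  negative exponents; the axes are null sets.
\<close>

lemma partial_energy_Times_le:
  fixes \<mu> :: "'a::euclidean_space measure" and \<nu> :: "'b::euclidean_space measure"
  assumes \<mu>: "finite_borel_measure \<mu>" and \<nu>: "finite_borel_measure \<nu>"
    and S [measurable]: "S \<in> sets borel" and T [measurable]: "T \<in> sets borel"
    and bound: "\<And>x y. x \<in> S \<Longrightarrow> y \<in> T \<Longrightarrow> x \<noteq> 0 \<Longrightarrow> y \<noteq> 0 \<Longrightarrow>
      norm (x, y) powr (u - real DIM('a \<times> 'b))
        \<le> C * (norm x powr (a - real DIM('a)) * norm y powr (b - real DIM('b)))"
    and C: "0 \<le> C"
  shows "partial_energy p u (\<mu> \<Otimes>\<^sub>M \<nu>) (S \<times> T)
    \<le> ennreal C * (partial_energy p a \<mu> S * partial_energy p b \<nu> T)"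
proof -
  have [measurable]: "fourier_transform \<mu> \<in> borel_measurable borel"
    "fourier_transform \<nu> \<in> borel_measurable borel"
    "fourier_transform (\<mu> \<Otimes>\<^sub>M \<nu>) \<in> borel_measurable borel"
    by (intro measurable_fourier_transform finite_borel_measure_pair \<mu> \<nu>)+
  have ST: "S \<times> T \<in> sets borel"
    unfolding borel_prod[symmetric] by (rule pair_measureI) (rule S T)+
  let ?q = "u - real DIM('a \<times> 'b)"
  let ?F = "\<lambda>z. ennreal (cmod (fourier_transform (\<mu> \<Otimes>\<^sub>M \<nu>) z) powr p * norm z powr ?q) * indicator (S \<times> T) z"
  let ?f = "\<lambda>x. ennreal (cmod (fourier_transform \<mu> x) powr p * norm x powr (a - real DIM('a))) * indicator S x"
  let ?g = "\<lambda>y. ennreal (cmod (fourier_transform \<nu> y) powr p * norm y powr (b - real DIM('b))) * indicator T y"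
  have F: "?F \<in> borel_measurable (lborel \<Otimes>\<^sub>M lborel)"
    unfolding lborel_prod using ST by measurable
  have "partial_energy p u (\<mu> \<Otimes>\<^sub>M \<nu>) (S \<times> T) = (\<integral>\<^sup>+z. ?F z \<partial>(lborel \<Otimes>\<^sub>M lborel))"
    unfolding partial_energy_def lborel_prod ..
  also have "\<dots> = (\<integral>\<^sup>+x. (\<integral>\<^sup>+y. ?F (x, y) \<partial>lborel) \<partial>lborel)"
    by (rule lborel.nn_integral_fst[OF F, symmetric])
  also have "\<dots> \<le> (\<integral>\<^sup>+x. (\<integral>\<^sup>+y. ennreal C * (?f x * ?g y) \<partial>lborel) \<partial>lborel)"
  proof (rule nn_integral_mono_AE, use AE_lborel_singleton[of 0] in eventually_elim)
    fix x :: 'a assume x: "x \<noteq> 0"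
    show "(\<integral>\<^sup>+y. ?F (x, y) \<partial>lborel) \<le> (\<integral>\<^sup>+y. ennreal C * (?f x * ?g y) \<partial>lborel)"
    proof (rule nn_integral_mono_AE, use AE_lborel_singleton[of 0] in eventually_elim)
      fix y :: 'b assume y: "y \<noteq> 0"
      show "?F (x, y) \<le> ennreal C * (?f x * ?g y)"
      proof (cases "x \<in> S \<and> y \<in> T")
        case True
        let ?c = "cmod (fourier_transform \<mu> x) powr p * cmod (fourier_transform \<nu> y) powr p"
        have "?c * norm (x, y) powr ?q
            \<le> ?c * (C * (norm x powr (a - real DIM('a)) * norm y powr (b - real DIM('b))))"
          using True x y by (intro mult_left_mono bound) auto
        then show ?thesis using True C
          by (simp add: fourier_transform_pair[OF \<mu> \<nu>] norm_mult powr_mult mult_ac ennreal_leI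
              flip: ennreal_mult')
      qed auto
    qed
  qed
  also have "\<dots> = (\<integral>\<^sup>+x. ennreal C * (?f x * partial_energy p b \<nu> T) \<partial>lborel)"
    unfolding partial_energy_def by (simp add: nn_integral_cmult)
  also have "\<dots> = ennreal C * (partial_energy p a \<mu> S * partial_energy p b \<nu> T)"
    unfolding partial_energy_def[of p a] by (simp add: nn_integral_cmult nn_integral_multc)
  finally show ?thesis .
qed

text \<open>
  Write \<open>u = s / \<theta>\<close>, \<open>a = A / \<theta>\<close> and so on.  Each factor is cut at radius 1.
  On the part near the origin every positive exponent \<open>a'\<close> is admissible for \<^const>\<open>partial_energy\<close>,
  away from it every \<open>a' \<le> a\<close>.  On each of the four regions the weight
  \<open>norm (x, y) powr (u - k - l)\<close> is dominated by a multiple of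
  \<open>norm x powr (a' - k) * norm y powr (b' - l)\<close> with admissible \<open>a'\<close> and \<open>b'\<close>:
  where only \<open>y\<close> is large this requires \<open>u \<le> k + b\<close>, where only \<open>x\<close> is large \<open>u \<le> a + l\<close>, and
  where both are large also \<open>u \<le> a + b\<close>.  A negative \<open>A\<close> stands for the absence
  of any decay.
\<close>

lemma product_energy_finite:
  fixes \<mu> :: "'a::euclidean_space measure" and \<nu> :: "'b::euclidean_space measure"
  assumes \<mu>: "finite_borel_measure \<mu>" and \<nu>: "finite_borel_measure \<nu>"
    and \<theta>: "0 < \<theta>" and s: "0 < s"
    and A: "A < 0 \<or> (\<exists>s'\<ge>A. energy s' \<theta> \<mu> < \<infinity>)"
    and B: "B < 0 \<or> (\<exists>s'\<ge>B. energy s' \<theta> \<nu> < \<infinity>)"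
    and sB: "s \<le> real DIM('a) * \<theta> + B" and sA: "s \<le> A + real DIM('b) * \<theta>" and sAB: "s \<le> A + B"
  shows "energy s \<theta> (\<mu> \<Otimes>\<^sub>M \<nu>) < \<infinity>"
proof -
  define p u a b where "p = 2 / \<theta>" and "u = s / \<theta>" and "a = A / \<theta>" and "b = B / \<theta>"
  define q where "q = u - real DIM('a \<times> 'b)"
  let ?k = "real DIM('a)" and ?l = "real DIM('b)"
  have q: "q = u - ?k - ?l" by (simp add: q_def)
  have p: "p \<ge> 0" and u: "u > 0" using \<theta> s by (simp_all add: p_def u_def)
  have ub: "u \<le> ?k + b" and ua: "u \<le> a + ?l" and uab: "u \<le> a + b"
    using sA sB sAB \<theta> by (simp_all add: u_def a_def b_def field_simps)
  have kl: "?k > 0" "?l > 0" by simp_all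
  have nearX: "partial_energy p a' \<mu> (cball 0 1) < \<infinity>" if "a' > 0" for a'
    by (rule partial_energy_ball_finite[OF \<mu> p that])
  have nearY: "partial_energy p b' \<nu> (cball 0 1) < \<infinity>" if "b' > 0" for b'
    by (rule partial_energy_ball_finite[OF \<nu> p that])
  have farX: "partial_energy p a' \<mu> (- ball 0 1) < \<infinity>" if a': "a' \<le> a" for a'
  proof (rule partial_energy_outside_finite[OF \<mu> p])
    show "a' < 0 \<or> (\<exists>c\<ge>a'. partial_energy p c \<mu> UNIV < \<infinity>)"
    proof (cases "A < 0")
      case True
      then have "a < 0" using \<theta> by (simp add: a_def divide_neg_pos)
      then show ?thesis using a' by linarith
    next
      case False
      then obtain s' where "s' \<ge> A" "energy s' \<theta> \<mu> < \<infinity>" using A by blast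
      then have "s' / \<theta> \<ge> a" "partial_energy p (s' / \<theta>) \<mu> UNIV < \<infinity>"
        unfolding energy_finite_iff_partial[OF \<theta>] a_def p_def using \<theta> by (auto intro: divide_right_mono)
      then show ?thesis using a' by (intro disjI2 exI[of _ "s' / \<theta>"]) auto
    qed
  qed
  have farY: "partial_energy p b' \<nu> (- ball 0 1) < \<infinity>" if b': "b' \<le> b" for b'
  proof (rule partial_energy_outside_finite[OF \<nu> p])
    show "b' < 0 \<or> (\<exists>c\<ge>b'. partial_energy p c \<nu> UNIV < \<infinity>)"
    proof (cases "B < 0")
      case True
      then have "b < 0" using \<theta> by (simp add: b_def divide_neg_pos)
      then show ?thesis using b' by linarith
    next
      case False
      then obtain s' where "s' \<ge> B" "energy s' \<theta> \<nu> < \<infinity>" using B by blast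
      then have "s' / \<theta> \<ge> b" "partial_energy p (s' / \<theta>) \<nu> UNIV < \<infinity>"
        unfolding energy_finite_iff_partial[OF \<theta>] b_def p_def using \<theta> by (auto intro: divide_right_mono)
      then show ?thesis using b' by (intro disjI2 exI[of _ "s' / \<theta>"]) auto
    qed
  qed
  let ?P = "\<mu> \<Otimes>\<^sub>M \<nu>"
  have region: "partial_energy p u ?P (S \<times> T) < \<infinity>"
    if "S \<in> sets borel" "T \<in> sets borel" "0 \<le> C"
      and "\<And>x y. x \<in> S \<Longrightarrow> y \<in> T \<Longrightarrow> x \<noteq> 0 \<Longrightarrow> y \<noteq> 0 \<Longrightarrow>
        norm (x, y) powr q \<le> C * (norm x powr (a' - ?k) * norm y powr (b' - ?l))"
      and "partial_energy p a' \<mu> S < \<infinity>" "partial_energy p b' \<nu> T < \<infinity>" for S T C a' b'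
  proof -
    have "partial_energy p u ?P (S \<times> T)
        \<le> ennreal C * (partial_energy p a' \<mu> S * partial_energy p b' \<nu> T)"
      by (rule partial_energy_Times_le[OF \<mu> \<nu> that(1,2) _ that(3)]) (rule that(4)[unfolded q_def])
    also have "\<dots> < \<infinity>" using that(5,6) by (simp add: ennreal_mult_less_top)
    finally show ?thesis .
  qed
  have ball: "cball (0::'a) 1 \<in> sets borel" "- ball (0::'a) 1 \<in> sets borel"
    "cball (0::'b) 1 \<in> sets borel" "- ball (0::'b) 1 \<in> sets borel" by auto
  have nn: "0 \<le> 2 powr \<bar>q\<bar>" by simp
  \<comment> \<open>Both variables small: for a singular weight split \<open>u\<close> proportionally to the dimensions,
    so that both exponents remain positive; otherwise the weight is bounded.\<close>
  have 1: "partial_energy p u ?P (cball 0 1 \<times> cball 0 1) < \<infinity>"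
  proof (cases "u \<le> ?k + ?l")
    case True
    let ?t = "u / (?k + ?l)"
    have "0 < ?k + ?l" using kl by linarith
    then have t: "0 < ?t" "?t \<le> 1" using True u by (simp_all only: divide_pos_pos divide_le_eq_1_pos)
    have le: "?k * ?t \<le> ?k * 1" "?l * ?t \<le> ?l * 1"
      using t(2) by (rule mult_left_mono, simp)+
    have "?k * ?t + ?l * ?t = (?k + ?l) * ?t" by (simp only: distrib_right)
    also have "\<dots> = u" using \<open>0 < ?k + ?l\<close> by (metis less_irrefl nonzero_mult_div_cancel_left times_divide_eq_right)
    finally have sum: "(?k * ?t - ?k) + (?l * ?t - ?l) = q" unfolding q by linarith
    show ?thesis
    proof (rule region[where C=1 and a'="?k * ?t" and b'="?l * ?t"])
      show "norm (x, y) powr q \<le> 1 * (norm x powr (?k * ?t - ?k) * norm y powr (?l * ?t - ?l))"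
        if "x \<noteq> 0" "y \<noteq> 0" for x :: 'a and y :: 'b
        using norm_Pair_powr_le[OF that, of "?k * ?t - ?k" "?l * ?t - ?l"] le unfolding sum by simp
      show "partial_energy p (?k * ?t) \<mu> (cball 0 1) < \<infinity>" by (rule nearX) (rule mult_pos_pos[OF kl(1) t(1)])
      show "partial_energy p (?l * ?t) \<nu> (cball 0 1) < \<infinity>" by (rule nearY) (rule mult_pos_pos[OF kl(2) t(1)])
    qed (rule ball | simp)+
  next
    case False
    then have q0: "q \<ge> 0" by (simp add: q)
    show ?thesis
    proof (rule region[where C="2 powr q" and a'="?k" and b'="?l"])
      show "norm (x, y) powr q \<le> 2 powr q * (norm x powr (?k - ?k) * norm y powr (?l - ?l))"
        if "x \<in> cball 0 1" "y \<in> cball 0 1" "x \<noteq> 0" "y \<noteq> 0" for x :: 'a and y :: 'b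
      proof -
        have "norm (x, y) \<le> 2" using that(1,2) norm_Pair_bounds(3)[of x y] by simp
        then have "norm (x, y) powr q \<le> 2 powr q" using q0 by (intro powr_mono2) auto
        then show ?thesis using that(3,4) by simp
      qed
    qed (rule ball nearX nearY kl | simp)+
  qed
  \<comment> \<open>Only \<open>y\<close> large: \<open>norm (x, y)\<close> is comparable with \<open>norm y\<close>, which carries the whole weight.\<close>
  have 2: "partial_energy p u ?P (cball 0 1 \<times> - ball 0 1) < \<infinity>"
  proof (rule region[where C="2 powr \<bar>q\<bar>" and a'="?k" and b'="u - ?k"])
    show "norm (x, y) powr q \<le> 2 powr \<bar>q\<bar> * (norm x powr (?k - ?k) * norm y powr (u - ?k - ?l))"
      if "x \<in> cball 0 1" "y \<in> - ball 0 1" "x \<noteq> 0" "y \<noteq> 0" for x :: 'a and y :: 'b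
    proof -
      have "norm x \<le> 1" "1 \<le> norm y" using that(1,2) by auto
      then have "norm (x, y) powr q \<le> 2 powr \<bar>q\<bar> * norm y powr q"
        using norm_Pair_bounds(2)[of y x] norm_Pair_bounds(3)[of x y] by (intro powr_comparable) linarith+
      then show ?thesis using that(3) unfolding q by simp
    qed
    show "partial_energy p (u - ?k) \<nu> (- ball 0 1) < \<infinity>" by (rule farY) (use ub in linarith)
  qed (rule ball nearX kl nn)+
  have 3: "partial_energy p u ?P ((- ball 0 1) \<times> cball 0 1) < \<infinity>"
  proof (rule region[where C="2 powr \<bar>q\<bar>" and a'="u - ?l" and b'="?l"])
    show "norm (x, y) powr q \<le> 2 powr \<bar>q\<bar> * (norm x powr (u - ?l - ?k) * norm y powr (?l - ?l))"
      if "x \<in> - ball 0 1" "y \<in> cball 0 1" "x \<noteq> 0" "y \<noteq> 0" for x :: 'a and y :: 'b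
    proof -
      have "norm y \<le> 1" "1 \<le> norm x" using that(1,2) by auto
      then have "norm (x, y) powr q \<le> 2 powr \<bar>q\<bar> * norm x powr q"
        using norm_Pair_bounds(1)[of x y] norm_Pair_bounds(3)[of x y] by (intro powr_comparable) linarith+
      moreover have "q = u - ?l - ?k" by (simp add: q)
      ultimately show ?thesis using that(4) by simp
    qed
    show "partial_energy p (u - ?l) \<mu> (- ball 0 1) < \<infinity>" by (rule farX) (use ua in linarith)
  qed (rule ball nearY kl nn)+
  \<comment> \<open>Both large: a decaying weight leaves to \<open>x\<close> as much as it can absorb, up to \<open>k\<close>, and the
    rest to \<open>y\<close>; a growing weight is submultiplicative up to a constant.\<close>
  have 4: "partial_energy p u ?P ((- ball 0 1) \<times> - ball 0 1) < \<infinity>"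
  proof (cases "u \<le> ?k + ?l")
    case True
    let ?a = "min a ?k"
    have le: "?a - ?k \<le> 0" "u - ?a - ?l \<le> 0" "u - ?a \<le> b"
      using True ua ub uab by (auto simp: min_def)
    have sum: "(?a - ?k) + (u - ?a - ?l) = q" unfolding q by simp
    show ?thesis
    proof (rule region[where C=1 and a'="?a" and b'="u - ?a"])
      show "norm (x, y) powr q \<le> 1 * (norm x powr (?a - ?k) * norm y powr (u - ?a - ?l))"
        if "x \<noteq> 0" "y \<noteq> 0" for x :: 'a and y :: 'b
        using norm_Pair_powr_le[OF that le(1,2)] unfolding sum by simp
      show "partial_energy p ?a \<mu> (- ball 0 1) < \<infinity>" by (rule farX) simp
      show "partial_energy p (u - ?a) \<nu> (- ball 0 1) < \<infinity>" by (rule farY) (rule le)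
    qed (rule ball | simp)+
  next
    case False
    then have q0: "q \<ge> 0" by (simp add: q)
    show ?thesis
    proof (rule region[where C="2 powr q" and a'="u - ?l" and b'="u - ?k"])
      show "norm (x, y) powr q \<le> 2 powr q * (norm x powr (u - ?l - ?k) * norm y powr (u - ?k - ?l))"
        if "x \<in> - ball 0 1" "y \<in> - ball 0 1" for x :: 'a and y :: 'b
      proof -
        have ge: "norm x \<ge> 1" "norm y \<ge> 1" using that by auto
        have "norm x \<le> norm x * norm y" "norm y \<le> norm x * norm y"
          using ge mult_left_mono[of 1 "norm y" "norm x"] mult_right_mono[of 1 "norm x" "norm y"] by auto
        then have "norm (x, y) \<le> 2 * (norm x * norm y)"
          using norm_Pair_bounds(3)[of x y] by linarith
        then have "norm (x, y) powr q \<le> (2 * (norm x * norm y)) powr q"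
          using q0 by (intro powr_mono2) auto
        also have "\<dots> = 2 powr q * (norm x powr q * norm y powr q)"
          by (simp add: powr_mult)
        also have "\<dots> = 2 powr q * (norm x powr (u - ?l - ?k) * norm y powr (u - ?k - ?l))"
          unfolding q by (simp add: algebra_simps)
        finally show ?thesis .
      qed
      show "partial_energy p (u - ?l) \<mu> (- ball 0 1) < \<infinity>" by (rule farX) (use ua in linarith)
      show "partial_energy p (u - ?k) \<nu> (- ball 0 1) < \<infinity>" by (rule farY) (use ub in linarith)
    qed (rule ball | simp)+
  qed
  have P: "finite_borel_measure ?P" by (rule finite_borel_measure_pair[OF \<mu> \<nu>])
  have [measurable]: "fourier_transform ?P \<in> borel_measurable borel"
    by (rule measurable_fourier_transform[OF P])
  have sets: "S \<times> T \<in> sets borel" if "S \<in> sets borel" "T \<in> sets borel" for S :: "'a set" and T :: "'b set"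
    unfolding borel_prod[symmetric] using that by (rule pair_measureI)
  have Un: "partial_energy p u ?P (U \<union> W) \<le> partial_energy p u ?P U + partial_energy p u ?P W"
    if [measurable]: "U \<in> sets borel" "W \<in> sets borel" for U W
  proof -
    let ?f = "\<lambda>z. ennreal (cmod (fourier_transform ?P z) powr p * norm z powr (u - real DIM('a \<times> 'b)))"
    have "partial_energy p u ?P (U \<union> W)
        \<le> (\<integral>\<^sup>+z. ?f z * indicator U z + ?f z * indicator W z \<partial>lborel)"
      unfolding partial_energy_def by (intro nn_integral_mono) (simp split: split_indicator)
    also have "\<dots> = partial_energy p u ?P U + partial_energy p u ?P W"
      unfolding partial_energy_def by (rule nn_integral_add) measurable
    finally show ?thesis .
  qed
  have fin_Un: "partial_energy p u ?P (U \<union> W) < \<infinity>"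
    if "U \<in> sets borel" "W \<in> sets borel" "partial_energy p u ?P U < \<infinity>" "partial_energy p u ?P W < \<infinity>" for U W
    using Un[OF that(1,2)] that(3,4) by (simp add: order.strict_trans1)
  have "partial_energy p u ?P ((cball 0 1 \<times> cball 0 1 \<union> cball 0 1 \<times> - ball 0 1)
      \<union> ((- ball 0 1) \<times> cball 0 1 \<union> (- ball 0 1) \<times> - ball 0 1)) < \<infinity>"
    by (intro fin_Un 1 2 3 4 sets.Un sets ball)
  moreover have "((cball (0::'a) 1 \<times> cball (0::'b) 1 \<union> cball 0 1 \<times> - ball 0 1)
      \<union> ((- ball 0 1) \<times> cball 0 1 \<union> (- ball 0 1) \<times> - ball 0 1)) = UNIV"
    by auto
  ultimately show ?thesis
    unfolding energy_finite_iff_partial[OF \<theta>] p_def u_def by simp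
qed

lemma energy_0_mono:
  assumes m: "finite_borel_measure m" and s: "0 \<le> s" "s \<le> s'" and fin: "energy s' 0 m < \<infinity>"
  shows "energy s 0 m < \<infinity>"
proof -
  obtain C where C: "\<And>z. (cmod (fourier_transform m z))\<^sup>2 * norm z powr s' \<le> C"
    using fin unfolding energy_0_finite_iff by blast
  have "(cmod (fourier_transform m z))\<^sup>2 * norm z powr s \<le> max C ((measure m UNIV)\<^sup>2 * 1)" for z
  proof (cases "norm z \<le> 1")
    case True
    then have "norm z powr s \<le> 1" using s by (intro powr_le1) auto
    then have "(cmod (fourier_transform m z))\<^sup>2 * norm z powr s \<le> (measure m UNIV)\<^sup>2 * 1"
      by (intro mult_mono power_mono norm_fourier_transform_le m) auto
    then show ?thesis by linarith
  next
    case False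
    then have "norm z powr s \<le> norm z powr s'" using s by (intro powr_mono) auto
    then have "(cmod (fourier_transform m z))\<^sup>2 * norm z powr s
        \<le> (cmod (fourier_transform m z))\<^sup>2 * norm z powr s'" by (intro mult_left_mono) auto
    then show ?thesis using C[of z] by linarith
  qed
  then show ?thesis unfolding energy_0_finite_iff by blast
qed

lemma product_energy_0_finite:
  fixes \<mu> :: "'a::euclidean_space measure" and \<nu> :: "'b::euclidean_space measure"
  assumes \<mu>: "finite_borel_measure \<mu>" "energy s 0 \<mu> < \<infinity>"
    and \<nu>: "finite_borel_measure \<nu>" "energy s 0 \<nu> < \<infinity>" and s: "0 \<le> s"
  shows "energy s 0 (\<mu> \<Otimes>\<^sub>M \<nu>) < \<infinity>"
proof -
  obtain C C' where C: "\<And>x. (cmod (fourier_transform \<mu> x))\<^sup>2 * norm x powr s \<le> C"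
    and C': "\<And>y. (cmod (fourier_transform \<nu> y))\<^sup>2 * norm y powr s \<le> C'"
    using \<mu>(2) \<nu>(2) unfolding energy_0_finite_iff by blast
  let ?M = "(measure \<mu> UNIV)\<^sup>2" and ?N = "(measure \<nu> UNIV)\<^sup>2"
  have M: "(cmod (fourier_transform \<mu> x))\<^sup>2 \<le> ?M" for x
    by (intro power_mono norm_fourier_transform_le \<mu>) auto
  have N: "(cmod (fourier_transform \<nu> y))\<^sup>2 \<le> ?N" for y
    by (intro power_mono norm_fourier_transform_le \<nu>) auto
  have "(cmod (fourier_transform (\<mu> \<Otimes>\<^sub>M \<nu>) z))\<^sup>2 * norm z powr s
      \<le> max (2 powr s * (C * ?N)) (2 powr s * (?M * C'))" for z
  proof (cases z)
    case (Pair x y)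
    let ?m = "(cmod (fourier_transform \<mu> x))\<^sup>2" and ?n = "(cmod (fourier_transform \<nu> y))\<^sup>2"
    have eq: "(cmod (fourier_transform (\<mu> \<Otimes>\<^sub>M \<nu>) z))\<^sup>2 = ?m * ?n"
      by (simp add: Pair fourier_transform_pair[OF \<mu>(1) \<nu>(1)] norm_mult power_mult_distrib)
    have pw: "norm z powr s \<le> 2 powr s * t powr s" if "norm x \<le> t" "norm y \<le> t" for t
    proof -
      have t: "0 \<le> t" using that(1) norm_ge_zero[of x] by linarith
      have "norm z powr s \<le> (2 * t) powr s"
        using s that norm_Pair_bounds(3)[of x y] unfolding Pair by (intro powr_mono2) auto
      then show ?thesis using t by (simp add: powr_mult)
    qed
    show ?thesis
    proof (cases "norm y \<le> norm x")
      case True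
      have "?m * ?n * norm z powr s \<le> ?m * ?n * (2 powr s * norm x powr s)"
        using True by (intro mult_left_mono pw) auto
      also have "\<dots> = 2 powr s * ((?m * norm x powr s) * ?n)" by (simp add: mult_ac)
      also have "\<dots> \<le> 2 powr s * (C * ?N)"
        using C[of x] order_trans[OF _ C[of x], of 0] by (intro mult_left_mono mult_mono N) auto
      finally show ?thesis unfolding eq by linarith
    next
      case False
      have "?m * ?n * norm z powr s \<le> ?m * ?n * (2 powr s * norm y powr s)"
        using False by (intro mult_left_mono pw) auto
      also have "\<dots> = 2 powr s * (?m * (?n * norm y powr s))" by (simp add: mult_ac)
      also have "\<dots> \<le> 2 powr s * (?M * C')"
        using C'[of y] by (intro mult_left_mono mult_mono M) auto
      finally show ?thesis unfolding eq by linarith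
    qed
  qed
  then show ?thesis unfolding energy_0_finite_iff by blast
qed

section \<open>From energies to spectra\<close>

lemma ennreal_le_measure_fourier_spectrum:
  "0 \<le> s \<Longrightarrow> energy s \<theta> m < \<infinity> \<Longrightarrow> ennreal s \<le> measure_fourier_spectrum \<theta> m"
  unfolding measure_fourier_spectrum_def by (rule Sup_upper) blast

lemma measure_fourier_spectrum_le_ext:
  "nonzero_finite_borel_measure m \<Longrightarrow> spt m \<subseteq> A \<Longrightarrow>
    measure_fourier_spectrum \<theta> m \<le> ext_fourier_spectrum \<theta> A"
  unfolding ext_fourier_spectrum_def by (rule Sup_upper) blast

lemma ennreal_le_fourier_spectrum:
  fixes A :: "'a::euclidean_space set"
  assumes "0 \<le> s" "energy s \<theta> m < \<infinity>" "s \<le> real DIM('a)"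
    "nonzero_finite_borel_measure m" "spt m \<subseteq> A"
  shows "ennreal s \<le> fourier_spectrum \<theta> A"
proof -
  have "ennreal s \<le> ennreal (real DIM('a))" using assms(3) by (rule ennreal_leI)
  then have "ennreal s \<le> min (measure_fourier_spectrum \<theta> m) (of_nat DIM('a))"
    using ennreal_le_measure_fourier_spectrum[OF assms(1,2)]
    by (simp add: ennreal_of_nat_eq_real_of_nat)
  also have "\<dots> \<le> fourier_spectrum \<theta> A"
    unfolding fourier_spectrum_def using assms(4,5) by (intro Sup_upper) blast
  finally show ?thesis .
qed

lemma fourier_spectrum_le_dim:
  "fourier_spectrum \<theta> (A :: 'a::euclidean_space set) \<le> of_nat DIM('a)"
  unfolding fourier_spectrum_def by (rule Sup_least) auto

text \<open>
  A bound \<open>A < 0\<close> asks for no decay at all, and a point mass will do; this is needed when the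
  extended spectrum of \<open>X\<close> is zero.
\<close>

lemma exists_measure_energy:
  fixes X :: "'a::euclidean_space set"
  assumes X: "closed X" "X \<noteq> {}" and A: "A < 0 \<or> ennreal A < ext_fourier_spectrum \<theta> X"
  obtains m where "nonzero_finite_borel_measure m" "spt m \<subseteq> X"
    "A < 0 \<or> (\<exists>s\<ge>A. energy s \<theta> m < \<infinity>)"
proof (cases "A < 0")
  case True
  obtain x where x: "x \<in> X" using X(2) by blast
  define \<delta> where "\<delta> = distr (count_space (UNIV :: unit set)) borel (\<lambda>_. x)"
  have em: "emeasure \<delta> A = indicator A x" if "A \<in> sets borel" for A
    unfolding \<delta>_def using that
    by (subst emeasure_distr) (auto simp: UNIV_unit split: split_indicator)
  have sets: "sets \<delta> = sets borel" and space: "space \<delta> = UNIV" by (simp_all add: \<delta>_def)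
  have "finite_measure \<delta>"
    by (rule finite_measureI) (simp add: em space)
  then have 1: "nonzero_finite_borel_measure \<delta>"
    unfolding nonzero_finite_borel_measure_def by (simp add: em sets space)
  have "- X \<in> sets borel" using X(1) by simp
  then have "emeasure \<delta> (- X) = 0" using x by (simp add: em)
  then have 2: "spt \<delta> \<subseteq> X" by (rule spt_subset_iff[OF sets X(1), THEN iffD2])
  show thesis by (rule that[OF 1 2]) (use True in simp)
next
  case False
  then obtain m where m: "nonzero_finite_borel_measure m" "spt m \<subseteq> X"
    and "ennreal A < measure_fourier_spectrum \<theta> m"
    using A unfolding ext_fourier_spectrum_def less_Sup_iff by blast
  then obtain s where s: "0 \<le> s" "energy s \<theta> m < \<infinity>" "ennreal A < ennreal s"
    unfolding measure_fourier_spectrum_def less_Sup_iff by blast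
  then have "A \<le> s" using False by (simp add: ennreal_less_iff)
  with m s(2) show thesis by (intro that) blast+
qed

lemma less_add_truncated_ennreal:
  fixes D E :: ennreal
  assumes "0 \<le> s" "ennreal s < D + E"
  shows "s < enn2real (min D (ennreal (s + 1))) + enn2real (min E (ennreal (s + 1)))"
proof -
  have trunc: "ennreal (enn2real (min D (ennreal (s + 1)))) = min D (ennreal (s + 1))" for D
    by (rule ennreal_enn2real) (auto simp: min_less_iff_disj)
  have "ennreal s < min D (ennreal (s + 1)) + min E (ennreal (s + 1))"
  proof (cases "ennreal (s + 1) \<le> D \<or> ennreal (s + 1) \<le> E")
    case True
    have "ennreal s < ennreal (s + 1)" using assms(1) by (simp add: ennreal_less_iff)
    also have "\<dots> \<le> min D (ennreal (s + 1)) + min E (ennreal (s + 1))"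
      using True by (auto simp: min_absorb2 intro: add_increasing add_increasing2)
    finally show ?thesis .
  next
    case False
    then show ?thesis using assms(2) by (simp add: min_absorb1 not_le less_imp_le)
  qed
  also have "\<dots> = ennreal (enn2real (min D (ennreal (s + 1))) + enn2real (min E (ennreal (s + 1))))"
    by (simp only: ennreal_plus enn2real_nonneg trunc)
  finally show ?thesis by (subst (asm) ennreal_less_iff) (use assms(1) in auto)
qed

text \<open>
  Truncating the extended spectra at \<open>s + 1\<close> makes them finite without affecting the strict
  inequalities, so that there is room to pass to nearly optimal measures on both factors.
\<close>

lemma fourier_spectrum_Times_ge:
  fixes X :: "'a::euclidean_space set" and Y :: "'b::euclidean_space set"
  assumes X: "closed X" "X \<noteq> {}" and Y: "closed Y" "Y \<noteq> {}" and \<theta>: "0 \<le> \<theta>"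
    and s0: "0 < s" and sd: "s \<le> real DIM('a \<times> 'b)"
    and sY: "ennreal s < ennreal (real DIM('a) * \<theta>) + ext_fourier_spectrum \<theta> Y"
    and sX: "ennreal s < ext_fourier_spectrum \<theta> X + ennreal (real DIM('b) * \<theta>)"
    and sXY: "ennreal s < ext_fourier_spectrum \<theta> X + ext_fourier_spectrum \<theta> Y"
  shows "ennreal s \<le> fourier_spectrum \<theta> (X \<times> Y)"
proof -
  let ?EX = "ext_fourier_spectrum \<theta> X" and ?EY = "ext_fourier_spectrum \<theta> Y"
  have "\<exists>\<mu> \<nu>. nonzero_finite_borel_measure \<mu> \<and> spt \<mu> \<subseteq> X \<and> nonzero_finite_borel_measure \<nu> \<and> spt \<nu> \<subseteq> Y
     \<and> energy s \<theta> (\<mu> \<Otimes>\<^sub>M \<nu>) < \<infinity>"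
  proof (cases "\<theta> = 0")
    case True
    obtain \<mu> where \<mu>: "nonzero_finite_borel_measure \<mu>" "spt \<mu> \<subseteq> X" "s < 0 \<or> (\<exists>s'\<ge>s. energy s' \<theta> \<mu> < \<infinity>)"
    proof (rule exists_measure_energy[OF X, of s \<theta>])
      show "s < 0 \<or> ennreal s < ?EX" using sX True by simp
    qed
    obtain \<nu> where \<nu>: "nonzero_finite_borel_measure \<nu>" "spt \<nu> \<subseteq> Y" "s < 0 \<or> (\<exists>s'\<ge>s. energy s' \<theta> \<nu> < \<infinity>)"
    proof (rule exists_measure_energy[OF Y, of s \<theta>])
      show "s < 0 \<or> ennreal s < ?EY" using sY True by simp
    qed
    have fin: "finite_borel_measure \<mu>" "finite_borel_measure \<nu>"
      using \<mu>(1) \<nu>(1) by (simp_all add: nonzero_finite_borel_measure_iff)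
    obtain s' where s': "s' \<ge> s" "energy s' 0 \<mu> < \<infinity>" using \<mu>(3) s0 unfolding True by auto
    obtain s'' where s'': "s'' \<ge> s" "energy s'' 0 \<nu> < \<infinity>" using \<nu>(3) s0 unfolding True by auto
    have "energy s 0 \<mu> < \<infinity>" by (rule energy_0_mono[OF fin(1) less_imp_le[OF s0] s'])
    moreover have "energy s 0 \<nu> < \<infinity>" by (rule energy_0_mono[OF fin(2) less_imp_le[OF s0] s''])
    ultimately have "energy s 0 (\<mu> \<Otimes>\<^sub>M \<nu>) < \<infinity>"
      using s0 by (intro product_energy_0_finite fin) auto
    then show ?thesis unfolding True by (intro exI[of _ \<mu>] exI[of _ \<nu>] conjI \<mu>(1,2) \<nu>(1,2))
  next
    case False
    then have \<theta>0: "\<theta> > 0" using \<theta> by simp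
    define eX eY where "eX = enn2real (min ?EX (ennreal (s + 1)))" and "eY = enn2real (min ?EY (ennreal (s + 1)))"
    have trunc: "ennreal (enn2real (min D (ennreal (s + 1)))) \<le> D" for D
      by (subst ennreal_enn2real) (auto simp: min_less_iff_disj)
    have eX_le: "ennreal eX \<le> ?EX" and eY_le: "ennreal eY \<le> ?EY"
      unfolding eX_def eY_def by (rule trunc)+
    have c: "enn2real (min (ennreal c) (ennreal (s + 1))) \<le> c" if "c \<ge> 0" for c
      using enn2real_mono[of "min (ennreal c) (ennreal (s + 1))" "ennreal c"] that by simp
    have s1: "s < real DIM('a) * \<theta> + eY"
      using less_add_truncated_ennreal[OF _ sY] s0 \<theta> c[of "real DIM('a) * \<theta>"] by (simp add: eY_def)
    have s2: "s < eX + real DIM('b) * \<theta>"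
      using less_add_truncated_ennreal[OF _ sX] s0 \<theta> c[of "real DIM('b) * \<theta>"] by (simp add: eX_def)
    have s3: "s < eX + eY"
      using less_add_truncated_ennreal[OF _ sXY] s0 by (simp add: eX_def eY_def)
    \<comment> \<open>The third slack is shared by both factors, hence halved.\<close>
    define \<epsilon> where "\<epsilon> = min (min (real DIM('a) * \<theta> + eY - s) (eX + real DIM('b) * \<theta> - s)) ((eX + eY - s) / 2)"
    have \<epsilon>: "\<epsilon> > 0" "s \<le> real DIM('a) * \<theta> + (eY - \<epsilon>)" "s \<le> (eX - \<epsilon>) + real DIM('b) * \<theta>"
        "s \<le> (eX - \<epsilon>) + (eY - \<epsilon>)"
    proof -
      have "\<epsilon> \<le> real DIM('a) * \<theta> + eY - s" "\<epsilon> \<le> eX + real DIM('b) * \<theta> - s" "\<epsilon> \<le> (eX + eY - s) / 2"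
        unfolding \<epsilon>_def
        by (intro min.coboundedI1 min.cobounded1, intro min.coboundedI1 min.cobounded2, rule min.cobounded2)
      then show "s \<le> real DIM('a) * \<theta> + (eY - \<epsilon>)" "s \<le> (eX - \<epsilon>) + real DIM('b) * \<theta>"
          "s \<le> (eX - \<epsilon>) + (eY - \<epsilon>)"
        by (simp_all add: field_simps)
      show "\<epsilon> > 0" using s1 s2 s3 unfolding \<epsilon>_def by simp
    qed
    have less: "E - \<epsilon> < 0 \<or> ennreal (E - \<epsilon>) < D" if "ennreal E \<le> D" for E D
    proof (cases "E - \<epsilon> < 0")
      case False
      then have "ennreal (E - \<epsilon>) < ennreal E" using \<epsilon>(1) by (simp add: ennreal_less_iff)
      from order.strict_trans2[OF this that] show ?thesis ..
    qed simp
    obtain \<mu> where \<mu>: "nonzero_finite_borel_measure \<mu>" "spt \<mu> \<subseteq> X"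
        "eX - \<epsilon> < 0 \<or> (\<exists>s'\<ge>eX - \<epsilon>. energy s' \<theta> \<mu> < \<infinity>)"
      by (rule exists_measure_energy[OF X less[OF eX_le]])
    obtain \<nu> where \<nu>: "nonzero_finite_borel_measure \<nu>" "spt \<nu> \<subseteq> Y"
        "eY - \<epsilon> < 0 \<or> (\<exists>s'\<ge>eY - \<epsilon>. energy s' \<theta> \<nu> < \<infinity>)"
      by (rule exists_measure_energy[OF Y less[OF eY_le]])
    have fin: "finite_borel_measure \<mu>" "finite_borel_measure \<nu>"
      using \<mu>(1) \<nu>(1) by (simp_all add: nonzero_finite_borel_measure_iff)
    have "energy s \<theta> (\<mu> \<Otimes>\<^sub>M \<nu>) < \<infinity>"
      by (rule product_energy_finite[OF fin \<theta>0 s0 \<mu>(3) \<nu>(3) \<epsilon>(2,3,4)])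
    then show ?thesis by (intro exI[of _ \<mu>] exI[of _ \<nu>] conjI \<mu>(1,2) \<nu>(1,2))
  qed
  then obtain \<mu> \<nu> where \<mu>: "nonzero_finite_borel_measure \<mu>" "spt \<mu> \<subseteq> X"
    and \<nu>: "nonzero_finite_borel_measure \<nu>" "spt \<nu> \<subseteq> Y"
    and fin: "energy s \<theta> (\<mu> \<Otimes>\<^sub>M \<nu>) < \<infinity>" by (elim exE conjE) (rule that)
  show ?thesis
    by (rule ennreal_le_fourier_spectrum[OF _ fin sd spt_pair_measure_subset[OF \<mu> X(1) \<nu> Y(1)]])
       (use s0 in simp)
qed

text \<open>
  Values \<open>s \<le> DIM('a) * \<theta>\<close> satisfy the bound trivially; the others survive projection.
\<close>

lemma fourier_spectrum_Times_le:
  fixes X :: "'a::euclidean_space set" and Y :: "'b::euclidean_space set"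
  assumes X: "compact X" and Y: "compact Y" and \<theta>: "0 \<le> \<theta>" "\<theta> \<le> 1"
  shows "fourier_spectrum \<theta> (X \<times> Y) \<le> ennreal (real DIM('a) * \<theta>) + ext_fourier_spectrum \<theta> Y"
proof -
  let ?k = "real DIM('a) * \<theta>"
  have each: "ennreal s \<le> ennreal ?k + ext_fourier_spectrum \<theta> Y"
    if m: "nonzero_finite_borel_measure m" "spt m \<subseteq> X \<times> Y" and s: "0 \<le> s" "energy s \<theta> m < \<infinity>"
    for m and s
  proof (cases "\<theta> = 0 \<or> s > ?k")
    case True
    obtain \<nu> where \<nu>: "nonzero_finite_borel_measure \<nu>" "spt \<nu> \<subseteq> Y" "energy (s - ?k) \<theta> \<nu> < \<infinity>"
      by (rule projection_energy_finite[OF X Y m \<theta> True s])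
    have nn: "0 \<le> s - ?k" using True s(1) by auto
    have "ennreal s = ennreal ?k + ennreal (s - ?k)"
      using nn \<theta> by (simp flip: ennreal_plus)
    also have "\<dots> \<le> ennreal ?k + ext_fourier_spectrum \<theta> Y"
      using ennreal_le_measure_fourier_spectrum[OF nn \<nu>(3)] measure_fourier_spectrum_le_ext[OF \<nu>(1,2)]
      by (intro add_left_mono) (rule order_trans)
    finally show ?thesis .
  next
    case False
    then have "ennreal s \<le> ennreal ?k" by (intro ennreal_leI) auto
    then show ?thesis by (rule order_trans) simp
  qed
  have "measure_fourier_spectrum \<theta> m \<le> ennreal ?k + ext_fourier_spectrum \<theta> Y"
    if "nonzero_finite_borel_measure m" "spt m \<subseteq> X \<times> Y" for m
    unfolding measure_fourier_spectrum_def
    by (rule Sup_least, clarify) (rule each[OF that]; assumption)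
  from min.coboundedI1[OF this] show ?thesis
    unfolding fourier_spectrum_def by (auto intro!: Sup_least)
qed

lemma fourier_spectrum_swap_le:
  fixes X :: "'a::euclidean_space set" and Y :: "'b::euclidean_space set"
  assumes XY: "closed X" "closed Y"
  shows "fourier_spectrum \<theta> (X \<times> Y) \<le> fourier_spectrum \<theta> (Y \<times> X)"
  unfolding fourier_spectrum_def[of \<theta> "X \<times> Y"]
proof (rule Sup_least, clarify)
  fix m :: "('a \<times> 'b) measure"
  assume m: "nonzero_finite_borel_measure m" "spt m \<subseteq> X \<times> Y"
  obtain n where n: "nonzero_finite_borel_measure n" "spt n \<subseteq> Y \<times> X"
    "\<And>s \<theta>. energy s \<theta> n = energy s \<theta> m"
    by (rule exists_swapped_measure[OF XY m]) (rule that; assumption)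
  have "min (measure_fourier_spectrum \<theta> m) (of_nat DIM('a \<times> 'b))
      = min (measure_fourier_spectrum \<theta> n) (of_nat DIM('b \<times> 'a))"
    unfolding measure_fourier_spectrum_def n(3) by (simp add: add.commute)
  also have "\<dots> \<le> fourier_spectrum \<theta> (Y \<times> X)"
    unfolding fourier_spectrum_def using n(1,2) by (intro Sup_upper) blast
  finally show "min (measure_fourier_spectrum \<theta> m) (of_nat DIM('a \<times> 'b)) \<le> fourier_spectrum \<theta> (Y \<times> X)" .
qed

section \<open>Fourier dimension of null sets\<close>

text \<open>
  A transform of order \<open>norm z powr (- s / 2)\<close> with \<open>s > DIM('a)\<close> is square integrable.
\<close>

lemma measure_fourier_spectrum_null_set_le:
  fixes X :: "'a::euclidean_space set"
  assumes X: "compact X" "X \<noteq> {}" "X \<in> null_sets lborel"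
    and m: "nonzero_finite_borel_measure m" "spt m \<subseteq> X"
  shows "measure_fourier_spectrum 0 m \<le> of_nat DIM('a)"
  unfolding measure_fourier_spectrum_def
proof (rule Sup_least, clarify)
  fix s :: real assume s: "0 \<le> s" "energy s 0 m < \<infinity>"
  let ?n = "real DIM('a)"
  have m': "finite_borel_measure m" using m(1) by (simp add: nonzero_finite_borel_measure_iff)
  have "s \<le> ?n"
  proof (rule ccontr)
    assume "\<not> s \<le> ?n"
    then have e: "s - ?n > 0" by simp
    obtain C where C: "\<And>z. (cmod (fourier_transform m z))\<^sup>2 * norm z powr s \<le> C"
      using s(2) unfolding energy_0_finite_iff by blast
    have far: "(\<integral>\<^sup>+z\<in>- ball 0 1. ennreal ((cmod (fourier_transform m z))\<^sup>2) \<partial>lborel)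
        \<le> ennreal C * (\<integral>\<^sup>+z::'a\<in>- ball 0 1. ennreal (norm z powr (- (s - ?n) - ?n)) \<partial>lborel)"
    proof -
      have "(\<integral>\<^sup>+z\<in>- ball 0 1. ennreal ((cmod (fourier_transform m z))\<^sup>2) \<partial>lborel)
        \<le> (\<integral>\<^sup>+(z::'a). ennreal C * (ennreal (norm z powr (- (s - ?n) - ?n)) * indicator (- ball 0 1) z) \<partial>lborel)"
      proof (rule nn_integral_mono)
        fix z :: 'a
        show "ennreal ((cmod (fourier_transform m z))\<^sup>2) * indicator (- ball 0 1) z
            \<le> ennreal C * (ennreal (norm z powr (- (s - ?n) - ?n)) * indicator (- ball 0 1) z)"
        proof (cases "norm z < 1")
          case False
          then have "norm z powr s > 0" by auto
          then have "(cmod (fourier_transform m z))\<^sup>2 \<le> C * norm z powr - s"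
            using C[of z] by (simp add: powr_minus field_simps)
          then show ?thesis using False by (simp add: ennreal_leI flip: ennreal_mult'')
        qed simp
      qed
      also have "\<dots> = ennreal C * (\<integral>\<^sup>+z::'a\<in>- ball 0 1. ennreal (norm z powr (- (s - ?n) - ?n)) \<partial>lborel)"
        by (rule nn_integral_cmult) measurable
      finally show ?thesis .
    qed
    have [measurable]: "fourier_transform m \<in> borel_measurable borel"
      by (rule measurable_fourier_transform[OF m'])
    have near: "(\<integral>\<^sup>+z\<in>ball 0 1. ennreal ((cmod (fourier_transform m z))\<^sup>2) \<partial>lborel)
        \<le> (\<integral>\<^sup>+z. ennreal ((measure m UNIV)\<^sup>2) * indicator (ball (0::'a) 1) z \<partial>lborel)"
      by (intro nn_integral_mono)
         (auto split: split_indicator intro!: ennreal_leI power_mono norm_fourier_transform_le[OF m'])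
    also have "\<dots> = ennreal ((measure m UNIV)\<^sup>2) * emeasure lborel (ball (0::'a) 1)"
      by (rule nn_integral_cmult_indicator) simp
    also have "\<dots> < \<infinity>"
      by (simp add: ennreal_mult_less_top emeasure_ball)
    finally have fin1: "(\<integral>\<^sup>+z\<in>ball 0 1. ennreal ((cmod (fourier_transform m z))\<^sup>2) \<partial>lborel) < \<infinity>" .
    note far
    also have "ennreal C * (\<integral>\<^sup>+z::'a\<in>- ball 0 1. ennreal (norm z powr (- (s - ?n) - ?n)) \<partial>lborel) < \<infinity>"
      using nn_integral_norm_powr_outside[OF e, where 'a='a] by (simp add: ennreal_mult_less_top)
    finally have fin2: "(\<integral>\<^sup>+z\<in>- ball 0 1. ennreal ((cmod (fourier_transform m z))\<^sup>2) \<partial>lborel) < \<infinity>" .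
    have [measurable]: "ball (0::'a) 1 \<in> sets borel" by simp
    let ?f = "\<lambda>z. ennreal ((cmod (fourier_transform m z))\<^sup>2)"
    have "(\<integral>\<^sup>+z. ?f z \<partial>lborel) = (\<integral>\<^sup>+z. ?f z * indicator (ball 0 1) z + ?f z * indicator (- ball 0 1) z \<partial>lborel)"
      by (intro nn_integral_cong) (simp split: split_indicator)
    also have "\<dots> = (\<integral>\<^sup>+z\<in>ball 0 1. ?f z \<partial>lborel) + (\<integral>\<^sup>+z\<in>- ball 0 1. ?f z \<partial>lborel)"
      by (rule nn_integral_add) measurable
    also have "\<dots> < \<infinity>" using fin1 fin2 by simp
    finally show False using nn_integral_fourier_transform_null_set[OF X m] by simp
  qed
  then have "ennreal s \<le> ennreal ?n" by (rule ennreal_leI)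
  then show "ennreal s \<le> of_nat DIM('a)" by (simp add: ennreal_of_nat_eq_real_of_nat)
qed

lemma fourier_dim_null_set:
  fixes X :: "'a::euclidean_space set"
  assumes X: "compact X" "X \<noteq> {}" "X \<in> null_sets lebesgue"
  shows "fourier_dim X = ext_fourier_dim X"
proof -
  have "X \<in> sets lborel" using X(1) by (simp add: borel_compact)
  then have "X \<in> null_sets lborel"
    using X(3) by (auto simp: null_sets_def)
  then have "min (measure_fourier_spectrum 0 m) (of_nat DIM('a)) = measure_fourier_spectrum 0 m"
    if "nonzero_finite_borel_measure m" "spt m \<subseteq> X" for m
    using measure_fourier_spectrum_null_set_le[OF X(1,2) _ that] by (simp add: min_absorb1)
  then have "{min (measure_fourier_spectrum 0 m) (of_nat DIM('a)) |m.
        nonzero_finite_borel_measure m \<and> spt m \<subseteq> X}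
      = {measure_fourier_spectrum 0 m |m. nonzero_finite_borel_measure m \<and> spt m \<subseteq> X}"
    by (intro Collect_cong) metis
  then show ?thesis
    unfolding fourier_dim_def ext_fourier_dim_def fourier_spectrum_def ext_fourier_spectrum_def
    by simp
qed

section \<open>Fourier spectra of product sets\<close>

theorem theorem3p2:
  fixes X :: "'a::euclidean_space set" and Y :: "'b::euclidean_space set" and k d :: nat
  assumes "1 \<le> k" and "k < d"
    and "DIM('a) = k" and "DIM('b) = d - k"
    and "compact X" and "X \<noteq> {}"
    and "compact Y" and "Y \<noteq> {}"
  shows "(\<forall>\<theta>\<in>{0..1::real}.
            fourier_spectrum \<theta> (X \<times> Y) \<ge>
              Min {ennreal (real k * \<theta>) + ext_fourier_spectrum \<theta> Y,
                   ext_fourier_spectrum \<theta> X + ennreal (real (d - k) * \<theta>),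
                   ext_fourier_spectrum \<theta> X + ext_fourier_spectrum \<theta> Y,
                   of_nat d}
          \<and> fourier_spectrum \<theta> (X \<times> Y) \<le>
              Min {ennreal (real k * \<theta>) + ext_fourier_spectrum \<theta> Y,
                   ext_fourier_spectrum \<theta> X + ennreal (real (d - k) * \<theta>),
                   of_nat d})
       \<and> fourier_dim (X \<times> Y) = Min {ext_fourier_dim X, ext_fourier_dim Y, of_nat d}
       \<and> (X \<in> null_sets lebesgue \<and> Y \<in> null_sets lebesgue \<longrightarrow>
            fourier_dim (X \<times> Y) = min (fourier_dim X) (fourier_dim Y))"
proof -
  note dims = \<open>DIM('a) = k\<close> \<open>DIM('b) = d - k\<close>
  have d: "DIM('a \<times> 'b) = d" using assms(2) dims by simp
  have closed: "closed X" "closed Y" using assms(5,7) by (auto intro: compact_imp_closed)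
  have lower: "Min {ennreal (real k * \<theta>) + ext_fourier_spectrum \<theta> Y,
                   ext_fourier_spectrum \<theta> X + ennreal (real (d - k) * \<theta>),
                   ext_fourier_spectrum \<theta> X + ext_fourier_spectrum \<theta> Y,
                   of_nat d} \<le> fourier_spectrum \<theta> (X \<times> Y)" (is "?M \<le> _")
    if \<theta>: "\<theta> \<in> {0..1}" for \<theta>
  proof (rule dense_le)
    fix t assume t: "t < ?M"
    then have less: "t < ennreal (real k * \<theta>) + ext_fourier_spectrum \<theta> Y"
      "t < ext_fourier_spectrum \<theta> X + ennreal (real (d - k) * \<theta>)"
      "t < ext_fourier_spectrum \<theta> X + ext_fourier_spectrum \<theta> Y" "t < of_nat d"
      by (simp_all add: Min_gr_iff)
    show "t \<le> fourier_spectrum \<theta> (X \<times> Y)"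
    proof (cases t)
      case (real s)
      then have t_eq: "t = ennreal s" by simp
      have sd: "s \<le> real DIM('a \<times> 'b)"
        using less(4) unfolding t_eq d by (simp add: ennreal_of_nat_eq_real_of_nat ennreal_less_iff real)
      have less': "ennreal s < ennreal (real DIM('a) * \<theta>) + ext_fourier_spectrum \<theta> Y"
        "ennreal s < ext_fourier_spectrum \<theta> X + ennreal (real DIM('b) * \<theta>)"
        "ennreal s < ext_fourier_spectrum \<theta> X + ext_fourier_spectrum \<theta> Y"
        using less(1,2,3) unfolding t_eq dims .
      have \<theta>0: "0 \<le> \<theta>" using \<theta> by simp
      show ?thesis
      proof (cases "s = 0")
        case False
        then have "0 < s" using real by simp
        from fourier_spectrum_Times_ge[OF closed(1) assms(6) closed(2) assms(8) \<theta>0 this sd less']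
        show ?thesis unfolding t_eq .
      qed (simp add: t_eq)
    next
      case top
      with less(4) show ?thesis by simp
    qed
  qed
  have upper: "fourier_spectrum \<theta> (X \<times> Y) \<le> Min {ennreal (real k * \<theta>) + ext_fourier_spectrum \<theta> Y,
                   ext_fourier_spectrum \<theta> X + ennreal (real (d - k) * \<theta>),
                   of_nat d}"
    if \<theta>: "\<theta> \<in> {0..1}" for \<theta>
  proof -
    have "fourier_spectrum \<theta> (X \<times> Y) \<le> ennreal (real k * \<theta>) + ext_fourier_spectrum \<theta> Y"
      using fourier_spectrum_Times_le[OF assms(5,7), of \<theta>] \<theta> unfolding dims by simp
    moreover have "fourier_spectrum \<theta> (X \<times> Y) \<le> ext_fourier_spectrum \<theta> X + ennreal (real (d - k) * \<theta>)"
      using order_trans[OF fourier_spectrum_swap_le[OF closed]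
          fourier_spectrum_Times_le[OF assms(7,5)], of \<theta>] \<theta> unfolding dims
      by (simp add: add.commute)
    moreover have "fourier_spectrum \<theta> (X \<times> Y) \<le> of_nat d"
      using fourier_spectrum_le_dim[of \<theta> "X \<times> Y"] unfolding d .
    ultimately show ?thesis by simp
  qed
  have dim: "fourier_dim (X \<times> Y) = Min {ext_fourier_dim X, ext_fourier_dim Y, of_nat d}"
  proof (rule antisym)
    show "fourier_dim (X \<times> Y) \<le> Min {ext_fourier_dim X, ext_fourier_dim Y, of_nat d}"
      using upper[of 0] by (simp add: fourier_dim_def ext_fourier_dim_def)
    let ?x = "ext_fourier_spectrum 0 X" and ?y = "ext_fourier_spectrum 0 Y"
    have "?x \<le> ?x + ?y" by simp
    then have "min ?x (min ?y (of_nat d)) \<le> min ?y (min ?x (min (?x + ?y) (of_nat d)))"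
      by (intro min.boundedI min.cobounded1 min.coboundedI2[OF min.cobounded1]
          min.coboundedI2[OF min.cobounded2] order_trans[OF min.cobounded1])
    also have "\<dots> \<le> fourier_spectrum 0 (X \<times> Y)" using lower[of 0] by simp
    finally show "Min {ext_fourier_dim X, ext_fourier_dim Y, of_nat d} \<le> fourier_dim (X \<times> Y)"
      by (simp add: fourier_dim_def ext_fourier_dim_def)
  qed
  have null_case: "fourier_dim (X \<times> Y) = min (fourier_dim X) (fourier_dim Y)"
    if null: "X \<in> null_sets lebesgue" "Y \<in> null_sets lebesgue"
  proof -
    have "fourier_dim X \<le> of_nat DIM('a)" unfolding fourier_dim_def by (rule fourier_spectrum_le_dim)
    also have "of_nat DIM('a) \<le> (of_nat d :: ennreal)" unfolding dims using assms(2) by simp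
    finally have "fourier_dim X \<le> of_nat d" .
    then have "min (fourier_dim X) (fourier_dim Y) \<le> of_nat d" by (rule min.coboundedI1)
    then have "min (min (fourier_dim X) (fourier_dim Y)) (of_nat d) = min (fourier_dim X) (fourier_dim Y)"
      by (rule min.absorb1)
    moreover have "fourier_dim (X \<times> Y) = min (min (fourier_dim X) (fourier_dim Y)) (of_nat d)"
      unfolding dim fourier_dim_null_set[OF assms(5,6) null(1), symmetric]
        fourier_dim_null_set[OF assms(7,8) null(2), symmetric]
      by (simp add: min.assoc)
    ultimately show ?thesis by (rule trans[rotated])
  qed
  show ?thesis
    by (intro conjI ballI impI)
       (assumption | rule lower upper dim null_case | erule conjunct1 conjunct2)+
qed

end
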